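(* Let $\mathcal{H}$ be a real Hilbert space, $P,S\in\mathcal{P}(\mathcal{H})$ and $\beta\in[0,4)$. Assume that $B:\mathcal{H}\to2^{\mathcal{H}}$, that $D:\mathcal{H}\to\mathcal{H}$ is $L_D$-Lipschitz continuous w.r.t. $\|\cdot\|$, that $E:\mathcal{H}\to\mathcal{H}$ is $\frac1\beta$-cocoercive w.r.t. $\|\cdot\|_P$, that $K:\mathcal{H}\to\mathcal{H}$ is linear skew-adjoint, that $B+D$ is maximally monotone, and that $\mathrm{zer}(B+D+E+K):=\{x:0\in Bx+Dx+Ex+Kx\}\ne\emptyset$. Suppose that for each $k\in\mathbb{N}$ we have $\theta_k\in[\epsilon_\theta,2-\epsilon_\theta]$ for some $\epsilon_\theta\in(0,1)$ (independent of $k$), that $Q_k:\mathcal{H}\to\mathcal{H}$ is maximally monotone, single-valued, and $L_Q$-Lipschitz continuous for some $L_Q>0$ (independent of $k$), and that $Q_k-D$ is $1$-strongly monotone w.r.t. $\|\cdot\|_P$. Put $M_k:=Q_k-D-K$, let $x_0\in\mathcal{H}$ and, for $k=0,1,\ldots$, let $$\hat x_k:=(Q_k+B)^{-1}(Q_k-D-K-E)x_k,$$ $$\mu_k:=\frac{\langle M_kx_k-M_k\hat x_k,x_k-\hat x_k\rangle-\frac{\beta}{4}\|x_k-\hat x_k\|_P^2}{\|M_kx_k-M_k\hat x_k\|_{S^{-1}}^2},$$ $$x_{k+1}:=x_k-\theta_k\mu_kS^{-1}(M_kx_k-M_k\hat x_k).$$ Then $(x_k)_{k\in\mathbb{N}}$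 converges weakly to some $\bar x\in\mathrm{zer}(B+D+E+K)$. Moreover, if $B+D+E+K$ is metrically subregular at all $z\in\mathrm{zer}(B+D+E+K)$ for $0$ and $\mathcal{H}$ is finite-dimensional, then $x_k\to\bar x\in\mathrm{zer}(B+D+E+K)$ locally R-linearly and $\mathrm{dist}_S(x_k,\mathrm{zer}(B+D+E+K))$ converges locally Q-linearly to zero.
   Context: $\mathcal{P}(\mathcal{H})$ is the set of bounded linear self-adjoint positive definite operators on $\mathcal{H}$ (positive definite in the sense that there are $0<\lambda_{\min}(P)\le\lambda_{\max}(P)<\infty$ with $\lambda_{\min}(P)\|x\|^2\le\langle x,Px\rangle\le\lambda_{\max}(P)\|x\|^2$ for all $x$); $\|x\|_P=\sqrt{\langle x,Px\rangle}$. $E$ is $\frac1\beta$-cocoercive w.r.t. $\|\cdot\|_P$ if $\langle Ex-Ey,x-y\rangle\ge\frac1\beta\|Ex-Ey\|_{P^{-1}}^2$ for all $x,y$; for $\beta=0$ this means that $E$ is constant. An operator $T:\mathcal{H}\to\mathcal{H}$ is $1$-strongly monotone w.r.t. $\|\cdot\|_P$ if $\langle Tx-Ty,x-y\rangle\ge\|x-y\|_P^2$ for all $x,y$. Linear skew-adjoint means bounded, linear, with $K^*=-K$. Convention: $\frac00=0$ (relevant for $\mu_k$ when $\hat x_k=x_k$). $\mathrm{dist}_S(x,H)=\inf_{y\in H}\|x-y\|_S$ ($+\infty$ if $H=\emptyset$). Metric subregularity: $F:\mathcal{H}\to2^{\mathcal{H}}$ is metrically subregular at $\bar x$ for $\bar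 y$ if $\bar y\in F\bar x$ and there exist $\kappa\in[0,\infty)$ and neighborhoods $\mathcal{U}$ of $\bar x$ and $\mathcal{V}$ of $\bar y$ such that $\mathrm{dist}_S(x,F^{-1}\bar y)\le\kappa\,\mathrm{dist}_S(\bar y,Fx\cap\mathcal{V})$ for all $x\in\mathcal{U}$. A nonnegative sequence $(d_k)$ converges locally Q-linearly to zero if there are $K_0\in\mathbb{N}$ and $c\in[0,1)$ with $d_{k+1}\le c\,d_k$ for all $k\ge K_0$; $x_k\to\bar x$ locally R-linearly if there are $K_0\in\mathbb{N}$, $R\ge0$ and $c\in[0,1)$ with $\|x_k-\bar x\|_S\le Rc^k$ for all $k\ge K_0$. The scheme is the paper's four-operator splitting method. *)

theory Defs
  imports "HOL-Analysis.Analysis" "HOL-Library.Set_Algebras"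
begin

text \<open>
  A real Hilbert space is a type of sort \<open>{real_inner, complete_space}\<close>. Set-valued operators are
  functions \<open>'a \<Rightarrow> 'a set\<close>, a single-valued operator \<open>T\<close> is identified with \<open>\<lambda>x. {T x}\<close>, and sums
  of operators use the pointwise addition of sets.
\<close>

definition pos_def_op :: "('a::real_inner \<Rightarrow> 'a) \<Rightarrow> bool" where
  "pos_def_op P \<longleftrightarrow> bounded_linear P \<and> adjoint P = P \<and>
     (\<exists>lmin lmax::real. 0 < lmin \<and> lmin \<le> lmax \<and>
        (\<forall>x. lmin * (norm x)\<^sup>2 \<le> inner x (P x) \<and> inner x (P x) \<le> lmax * (norm x)\<^sup>2))"

definition skew_adjoint_op :: "('a::real_inner \<Rightarrow> 'a) \<Rightarrow> bool" where
  "skew_adjoint_op K \<longleftrightarrow> bounded_linear K \<and> adjoint K = (\<lambda>x. - K x)"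

definition norm_wrt :: "('a::real_inner \<Rightarrow> 'a) \<Rightarrow> 'a \<Rightarrow> real" where
  "norm_wrt P x = sqrt (inner x (P x))"

text \<open>
  The norm induced by the inverse of \<open>P\<close> is \<open>norm_wrt (inv P)\<close>; every \<open>P\<close> with \<open>pos_def_op P\<close> is a
  bijection of the Hilbert space. For \<open>\<beta> = 0\<close>, \<open>1/\<beta>\<close>-cocoercivity means that the operator is
  constant, which is spelled out because \<open>1 / 0 = 0\<close> in HOL.
\<close>

definition inv_cocoercive_wrt :: "('a::real_inner \<Rightarrow> 'a) \<Rightarrow> real \<Rightarrow> ('a \<Rightarrow> 'a) \<Rightarrow> bool" where
  "inv_cocoercive_wrt P \<beta> E \<longleftrightarrow>
     (if \<beta> = 0 then (\<forall>x y. E x = E y)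
      else (\<forall>x y. inner (E x - E y) (x - y) \<ge> 1 / \<beta> * (norm_wrt (inv P) (E x - E y))\<^sup>2))"

definition one_strongly_monotone_wrt :: "('a::real_inner \<Rightarrow> 'a) \<Rightarrow> ('a \<Rightarrow> 'a) \<Rightarrow> bool" where
  "one_strongly_monotone_wrt P T \<longleftrightarrow>
     (\<forall>x y. inner (T x - T y) (x - y) \<ge> (norm_wrt P (x - y))\<^sup>2)"

definition monotone_op :: "('a::real_inner \<Rightarrow> 'a set) \<Rightarrow> bool" where
  "monotone_op A \<longleftrightarrow> (\<forall>x y. \<forall>u\<in>A x. \<forall>v\<in>A y. inner (u - v) (x - y) \<ge> 0)"

definition maximally_monotone :: "('a::real_inner \<Rightarrow> 'a set) \<Rightarrow> bool" where
  "maximally_monotone A \<longleftrightarrow> monotone_op A \<and>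
     (\<forall>A'. monotone_op A' \<and> (\<forall>x. A x \<subseteq> A' x) \<longrightarrow> A' = A)"

definition inv_op :: "('a \<Rightarrow> 'a set) \<Rightarrow> 'a \<Rightarrow> 'a set" where
  "inv_op A y = {x. y \<in> A x}"

definition zer :: "('a::real_inner \<Rightarrow> 'a set) \<Rightarrow> 'a set" where
  "zer A = {x. 0 \<in> A x}"

text \<open>Extended-real valued, so that the distance to the empty set is \<open>\<infinity>\<close>.\<close>

definition dist_wrt :: "('a::real_inner \<Rightarrow> 'a) \<Rightarrow> 'a \<Rightarrow> 'a set \<Rightarrow> ereal" where
  "dist_wrt S x H = (INF y\<in>H. ereal (norm_wrt S (x - y)))"

text \<open>
  A neighbourhood of a point is a set containing the point in its interior. For \<open>\<kappa> = 0\<close> the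
  product \<open>0 * \<infinity>\<close> may occur below; its value is immaterial, because whichever value is chosen,
  if \<open>\<kappa> = 0\<close> satisfies the estimate then so does every \<open>\<kappa> > 0\<close>.
\<close>

definition metrically_subregular_at ::
  "('a::real_inner \<Rightarrow> 'a) \<Rightarrow> ('a \<Rightarrow> 'a set) \<Rightarrow> 'a \<Rightarrow> 'a \<Rightarrow> bool" where
  "metrically_subregular_at S F xbar ybar \<longleftrightarrow> ybar \<in> F xbar \<and>
     (\<exists>\<kappa>::real. \<exists>U V. 0 \<le> \<kappa> \<and> xbar \<in> interior U \<and> ybar \<in> interior V \<and>
        (\<forall>x\<in>U. dist_wrt S x (inv_op F ybar) \<le> ereal \<kappa> * dist_wrt S ybar (F x \<inter> V)))"

definition weakly_converges_to :: "(nat \<Rightarrow> 'a::real_inner) \<Rightarrow> 'a \<Rightarrow> bool" where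
  "weakly_converges_to x xbar \<longleftrightarrow> (\<forall>y. (\<lambda>k. inner (x k) y) \<longlonglongrightarrow> inner xbar y)"

definition finite_dimensional :: "'a::real_vector itself \<Rightarrow> bool" where
  "finite_dimensional _ \<longleftrightarrow> (\<exists>X::'a set. finite X \<and> span X = UNIV)"

text \<open>The first conjunct says that \<open>d\<close> is a sequence of nonnegative real numbers.\<close>

definition locally_Q_linear :: "(nat \<Rightarrow> ereal) \<Rightarrow> bool" where
  "locally_Q_linear d \<longleftrightarrow> (\<forall>k. 0 \<le> d k \<and> d k < \<infinity>) \<and>
     (\<exists>K0. \<exists>c::real. 0 \<le> c \<and> c < 1 \<and> (\<forall>k\<ge>K0. d (Suc k) \<le> ereal c * d k))"

definition locally_R_linear ::
  "('a::real_inner \<Rightarrow> 'a) \<Rightarrow> (nat \<Rightarrow> 'a) \<Rightarrow> 'a \<Rightarrow> bool" where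
  "locally_R_linear S x xbar \<longleftrightarrow>
     (\<exists>K0. \<exists>R c::real. 0 \<le> R \<and> 0 \<le> c \<and> c < 1 \<and>
        (\<forall>k\<ge>K0. norm_wrt S (x k - xbar) \<le> R * c ^ k))"

end

theory Submission
  imports Defs
begin

text \<open>
  Put \<open>A = B + D\<close>, \<open>T = E + K\<close>, \<open>e\<^sub>k = x\<^sub>k - xhat\<^sub>k\<close> and \<open>y\<^sub>k = M\<^sub>k x\<^sub>k - M\<^sub>k xhat\<^sub>k\<close>. Since
  \<open>Q\<^sub>k - D\<close> is Lipschitz and strongly monotone, \<open>xhat\<^sub>k\<close> is well defined by Minty's theorem and
  Banach's fixed point theorem, and \<open>u\<^sub>k = y\<^sub>k - E x\<^sub>k + E xhat\<^sub>k\<close> lies in \<open>(A + T) xhat\<^sub>k\<close>.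
  Monotonicity and cocoercivity show that every zero \<open>z\<close> of \<open>A + T\<close> satisfies
  \<open>inner y\<^sub>k (x\<^sub>k - z) \<ge> N\<^sub>k\<close>, where \<open>N\<^sub>k\<close> is the numerator of \<open>\<mu>\<^sub>k\<close>. So \<open>x\<^sub>k\<^sub>+\<^sub>1\<close> is a relaxed
  projection of \<open>x\<^sub>k\<close> onto a halfspace containing all zeros, and the squared \<open>S\<close>-distance to each zero
  drops by at least \<open>\<rho> (norm e\<^sub>k)\<^sup>2\<close> with a uniform \<open>\<rho> > 0\<close>. Hence \<open>e\<^sub>k\<close> and \<open>u\<^sub>k\<close> tend to \<open>0\<close>, weak
  cluster points are zeros, and Opial's argument gives weak convergence. Under metric subregularity
  the distance to the zero set is eventually bounded by a multiple of \<open>norm e\<^sub>k\<close>, which turns the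
  descent inequality into linear convergence.
\<close>

section \<open>Minty's theorem\<close>

text \<open>
  \<open>C\<close> plays the role of the epigraph of a convex function that may take the value \<open>\<infinity>\<close>.
\<close>

lemma strongly_convex_minimizer:
  fixes C :: "('b::{real_inner, complete_space} \<times> real) set"
  assumes "closed C" "convex C" "C \<noteq> {}"
    and bd: "\<And>y s. (y, s) \<in> C \<Longrightarrow> b \<le> s + (norm y)\<^sup>2 / 2"
  shows "\<exists>x t. (x, t) \<in> C \<and> (\<forall>y s. (y, s) \<in> C \<longrightarrow> 0 \<le> s - t + inner x (y - x))"
proof -
  define g where "g z = snd z + (norm (fst z))\<^sup>2 / 2" for z :: "'b \<times> real"
  define m where "m = (INF z\<in>C. g z)"
  have bdd: "bdd_below (g ` C)"
    unfolding bdd_below_def using bd by (fastforce simp: g_def)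
  have m_le: "m \<le> g z" if "z \<in> C" for z
    unfolding m_def by (intro cINF_lower bdd that)
  have "\<exists>z\<in>C. g z < m + 1 / real (Suc n)" for n
    using cInf_lessD[of "g ` C" "m + 1 / real (Suc n)"] \<open>C \<noteq> {}\<close> by (auto simp: m_def)
  then obtain z where z: "\<And>n. z n \<in> C" "\<And>n. g (z n) < m + 1 / real (Suc n)" by metis
  define x where "x n = fst (z n)" for n
  \<comment> \<open>Midpoints stay in \<open>C\<close>. By the parallelogram identity their value
    undercuts the mean of the two values by an eighth of the squared distance of the first
    components, which makes the minimizing sequence \<open>x\<close> Cauchy.\<close>
  have dist_le: "(norm (x n - x k))\<^sup>2 \<le> 4 * (1 / real (Suc n) + 1 / real (Suc k))" for n k
  proof -
    let ?w = "(1/2) *\<^sub>R z n + (1/2) *\<^sub>R z k"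
    have "?w \<in> C" using \<open>convex C\<close> z(1) by (intro convexD) auto
    then have "m \<le> g ?w" by (rule m_le)
    also have "g ?w = (g (z n) + g (z k)) / 2 - (norm (x n - x k))\<^sup>2 / 8"
      by (simp add: g_def x_def power2_norm_eq_inner inner_add inner_diff inner_commute field_simps)
    finally show ?thesis using z(2)[of n] z(2)[of k] by argo
  qed
  have "Cauchy x"
  proof (rule metric_CauchyI)
    fix e :: real assume "0 < e"
    then obtain N where N: "1 / real (Suc N) < e\<^sup>2 / 8"
      using nat_approx_posE[of "e\<^sup>2 / 8"] by auto
    have "dist (x n) (x k) < e" if "n \<ge> N" "k \<ge> N" for n k
    proof -
      have "1 / real (Suc n) \<le> 1 / real (Suc N)" "1 / real (Suc k) \<le> 1 / real (Suc N)"
        using that by (auto intro!: divide_left_mono)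
      then have "(norm (x n - x k))\<^sup>2 < e\<^sup>2" using dist_le[of n k] N by argo
      then show ?thesis using \<open>0 < e\<close> by (simp add: dist_norm power_less_imp_less_base)
    qed
    then show "\<exists>M. \<forall>m\<ge>M. \<forall>n\<ge>M. dist (x m) (x n) < e" by blast
  qed
  then obtain x0 where x0: "x \<longlonglongrightarrow> x0" by (meson Cauchy_convergent convergent_def)
  have gz: "(\<lambda>n. g (z n)) \<longlonglongrightarrow> m"
  proof (rule tendsto_sandwich[OF _ _ tendsto_const])
    show "(\<lambda>n. m + 1 / real (Suc n)) \<longlonglongrightarrow> m"
      using LIMSEQ_inverse_real_of_nat_add[of m] by (simp add: inverse_eq_divide)
  qed (auto intro!: always_eventually m_le z less_imp_le[OF z(2)] simp del: of_nat_Suc)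
  \<comment> \<open>The height with \<open>g (x0, t0) = m\<close>. The second components converge to
    it because \<open>g (z n)\<close> and \<open>norm (x n)\<close> both converge.\<close>
  define t0 where "t0 = m - (norm x0)\<^sup>2 / 2"
  have "(\<lambda>n. g (z n) - (norm (x n))\<^sup>2 / 2) \<longlonglongrightarrow> t0"
    unfolding t0_def by (intro tendsto_diff tendsto_divide tendsto_power tendsto_norm gz x0) auto
  then have "(\<lambda>n. (x n, snd (z n))) \<longlonglongrightarrow> (x0, t0)"
    by (intro tendsto_Pair x0) (simp add: g_def x_def)
  then have C0: "(x0, t0) \<in> C"
    by (rule closed_sequentially[OF \<open>closed C\<close>, rotated]) (simp add: x_def z(1))
  have "0 \<le> s - t0 + inner x0 (y - x0)" if ys: "(y, s) \<in> C" for y s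
  proof (rule ccontr)
    define D where "D = s - t0 + inner x0 (y - x0)"
    assume "\<not> ?thesis"
    then have "D < 0" by (simp add: D_def)
    define N where "N = (norm (y - x0))\<^sup>2"
    \<comment> \<open>Moving the fraction \<open>l\<close> from the minimizer towards
      \<open>(y, s)\<close> changes \<open>g\<close> by \<open>l * D + l * l * N / 2\<close>. The
      choice ensures \<open>l * N \<le> - D\<close>, so the change would be negative; the
      \<open>+ 1\<close> covers \<open>y = x0\<close>.\<close>
    define l where "l = min 1 (- D / (N + 1))"
    have "0 \<le> N" by (simp add: N_def)
    have l: "0 < l" "l \<le> 1" using \<open>D < 0\<close> \<open>0 \<le> N\<close> by (auto simp: l_def divide_neg_pos)
    have "(1 - l) *\<^sub>R (x0, t0) + l *\<^sub>R (y, s) \<in> C"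
      using \<open>convex C\<close> C0 ys l by (intro convexD) auto
    then have "m \<le> g ((1 - l) *\<^sub>R (x0, t0) + l *\<^sub>R (y, s))" by (rule m_le)
    also have "\<dots> = m + l * D + l * l * N / 2"
      by (simp add: g_def t0_def D_def N_def power2_norm_eq_inner inner_add inner_diff
          inner_commute field_simps)
    finally have "0 \<le> l * (D + l * N / 2)" by (simp add: algebra_simps)
    then have "0 \<le> D + l * N / 2" using l by (simp add: zero_le_mult_iff)
    moreover have "l * N \<le> - D"
    proof -
      have "l * N \<le> l * (N + 1)" using l by simp
      also have "\<dots> \<le> (- D / (N + 1)) * (N + 1)"
        using \<open>0 \<le> N\<close> by (intro mult_right_mono) (auto simp: l_def)
      finally show ?thesis using \<open>0 \<le> N\<close> by simp
    qed
    ultimately show False using \<open>D < 0\<close> by linarith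
  qed
  with C0 show ?thesis by blast
qed

text \<open>The representing vector minimizes half the squared norm minus \<open>f\<close>. Its
  variational inequality on the graph of \<open>- f\<close> gives
  \<open>f y \<le> inner x y\<close>, and replacing \<open>y\<close> by \<open>- y\<close> gives
  equality.\<close>

lemma Riesz_representation:
  fixes f :: "'a::{real_inner, complete_space} \<Rightarrow> real"
  assumes "bounded_linear f"
  obtains p where "\<And>y. f y = inner p y"
proof -
  interpret bounded_linear f by fact
  have neg: "f (- y) = - f y" for y by (rule linear_neg[OF linear])
  obtain c where c: "\<And>y. norm (f y) \<le> norm y * c" using bounded by blast
  let ?C = "{z. snd z = - f (fst z)}"
  have C: "closed ?C"
    by (intro closed_Collect_eq continuous_on_snd continuous_on_minus continuous_on continuous_on_fst
        continuous_on_id)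
  have C': "convex ?C" by (auto simp: convex_def add scaleR algebra_simps)
  have "(0, 0) \<in> ?C" by (simp add: zero)
  then have C'': "?C \<noteq> {}" by blast
  \<comment> \<open>The constant comes from completing the square in \<open>norm y\<close>.\<close>
  have bd: "- c\<^sup>2 / 2 \<le> s + (norm y)\<^sup>2 / 2" if "(y, s) \<in> ?C" for y s
    using that c[of y] zero_le_power2[of "norm y - c"] by (simp add: power2_eq_square algebra_simps)
  obtain x t where xt: "(x, t) \<in> ?C"
    "\<And>y s. (y, s) \<in> ?C \<Longrightarrow> 0 \<le> s - t + inner x (y - x)"
    using strongly_convex_minimizer[OF C C' C'' bd] by blast
  have "f y \<le> inner x y" for y
    using xt(2)[of "x + y" "- f (x + y)"] xt(1) by (simp add: add)
  then have "f y = inner x y" for y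
    using neg by (metis inner_minus_right neg_le_iff_le order_antisym)
  then show thesis by (rule that)
qed

text \<open>\<open>adjoint\<close> is defined by choice, so its characteristic identity presupposes
  that some adjoint exists. Riesz representation supplies one in arbitrary dimension.\<close>

lemma adjoint_inner:
  fixes f :: "'a::{real_inner, complete_space} \<Rightarrow> 'a"
  assumes "bounded_linear f"
  shows "inner (f x) y = inner x (adjoint f y)"
proof -
  have "\<exists>p. \<forall>x. inner (f x) y = inner x p" for y
  proof -
    have "bounded_linear (\<lambda>x. inner (f x) y)"
      using bounded_linear_compose[OF bounded_linear_inner_left assms] .
    then show ?thesis by (metis Riesz_representation inner_commute)
  qed
  then have "\<exists>f'. \<forall>x y. inner (f x) y = inner x (f' y)" by metis
  then show ?thesis
    unfolding adjoint_def by (rule someI2_ex) blast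
qed

text \<open>A pair monotonically related to the whole graph can be added to it without losing
  monotonicity. This replaces the quantifier over operators by one over pairs.\<close>

lemma maximally_monotone_iff:
  "maximally_monotone A \<longleftrightarrow>
     monotone_op A \<and> (\<forall>x u. (\<forall>a. \<forall>b\<in>A a. 0 \<le> inner (u - b) (x - a)) \<longrightarrow> u \<in> A x)"
proof (intro iffI conjI allI impI)
  assume A: "maximally_monotone A"
  then show mono: "monotone_op A" by (simp add: maximally_monotone_def)
  fix x u assume rel: "\<forall>a. \<forall>b\<in>A a. 0 \<le> inner (u - b) (x - a)"
  have rel': "0 \<le> inner (b - u) (a - x)" if "b \<in> A a" for a b
    using rel[rule_format, OF that] by (simp add: inner_diff algebra_simps)
  have "monotone_op (A(x := insert u (A x)))"
    using mono rel rel' by (auto simp: monotone_op_def)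
  then have "A(x := insert u (A x)) = A"
    using A by (auto simp: maximally_monotone_def)
  then show "u \<in> A x" by (metis fun_upd_same insertI1)
next
  assume A: "monotone_op A \<and> (\<forall>x u. (\<forall>a. \<forall>b\<in>A a. 0 \<le> inner (u - b) (x - a)) \<longrightarrow> u \<in> A x)"
  have "A' = A" if mono: "monotone_op A'" and sub: "\<forall>x. A x \<subseteq> A' x" for A'
  proof
    fix x
    have "u \<in> A x" if "u \<in> A' x" for u
    proof -
      have "\<forall>a. \<forall>b\<in>A a. 0 \<le> inner (u - b) (x - a)"
        using mono sub that by (auto simp: monotone_op_def subset_iff)
      then show ?thesis using A by blast
    qed
    then show "A' x = A x" using sub by blast
  qed
  then show "maximally_monotone A" using A by (auto simp: maximally_monotone_def)
qed

lemma maximally_monotone_memI: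
  assumes "maximally_monotone A" "\<And>a b. b \<in> A a \<Longrightarrow> 0 \<le> inner (u - b) (x - a)"
  shows "u \<in> A x"
  using assms unfolding maximally_monotone_iff by blast

lemma maximally_monotoneD:
  assumes "maximally_monotone A" "u \<in> A x" "v \<in> A y"
  shows "0 \<le> inner (u - v) (x - y)"
  using assms unfolding maximally_monotone_def monotone_op_def by blast

text \<open>
  Simons and Zalinescu's route to Minty's theorem: minimize the Fitzpatrick function
  \<open>F (x, u) = sup {inner x b + inner a u - inner a b | b \<in> A a}\<close> plus half the squared norm.
  Maximality enters through \<open>inner x u \<le> F (x, u)\<close>.
\<close>

lemma Minty_zero:
  fixes A :: "'a::{real_inner, complete_space} \<Rightarrow> 'a set"
  assumes A: "maximally_monotone A"
  shows "\<exists>x. - x \<in> A x"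
proof -
  define C where "C = {z :: ('a \<times> 'a) \<times> real. \<forall>a. \<forall>b\<in>A a.
     inner (fst (fst z)) b + inner a (snd (fst z)) - inner a b \<le> snd z}"
  \<comment> \<open>Every pair is vacuously related to an empty graph, so maximality excludes an
    empty graph.\<close>
  obtain a0 b0 where ab0: "b0 \<in> A a0" using maximally_monotone_memI[OF A] by blast
  have graph: "((a, b), inner a b) \<in> C" if "b \<in> A a" for a b
    using maximally_monotoneD[OF A that] by (force simp: C_def inner_diff inner_commute)
  \<comment> \<open>If \<open>t < inner x u\<close>, the constraints defining \<open>C\<close> make
    \<open>(x, u)\<close> monotonically related to the graph, hence a graph point; the constraint at
    \<open>(x, u)\<close> itself then contradicts this.\<close>
  have Fitz: "inner x u \<le> t" if "((x, u), t) \<in> C" for x u t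
  proof (rule ccontr)
    assume less: "\<not> inner x u \<le> t"
    have "0 \<le> inner (u - b) (x - a)" if "b \<in> A a" for a b
      using \<open>((x, u), t) \<in> C\<close> less that by (force simp: C_def inner_diff inner_commute)
    then have "u \<in> A x" by (rule maximally_monotone_memI[OF A])
    then show False using \<open>((x, u), t) \<in> C\<close> less by (force simp: C_def)
  qed
  have C_eq: "C = (\<Inter>a. \<Inter>b\<in>A a. {z. inner ((b, a), - 1) z \<le> inner a b})"
    by (auto simp: C_def inner_commute algebra_simps)
  have C: "closed C" unfolding C_eq by (intro closed_INT ballI closed_halfspace_le)
  have C': "convex C" unfolding C_eq by (intro convex_INT convex_halfspace_le)
  have C'': "C \<noteq> {}" using graph[OF ab0] by blast
  have bd: "0 \<le> t + (norm z)\<^sup>2 / 2" if "(z, t) \<in> C" for z t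
  proof -
    have "0 \<le> inner (fst z + snd z) (fst z + snd z)" by simp
    also have "\<dots> = 2 * inner (fst z) (snd z) + (norm z)\<^sup>2"
      by (cases z) (simp add: power2_norm_eq_inner inner_add inner_commute)
    finally show ?thesis using Fitz[of "fst z" "snd z" t] that by simp
  qed
  obtain z0 t where zt: "(z0, t) \<in> C"
    "\<And>y s. (y, s) \<in> C \<Longrightarrow> 0 \<le> s - t + inner z0 (y - z0)"
    using strongly_convex_minimizer[OF C C' C'' bd] by blast
  obtain x u where z0: "z0 = (x, u)" by fastforce
  have "inner x u \<le> t" using zt(1) Fitz z0 by blast
  \<comment> \<open>The variational inequality is tested at graph points, which lie in
    \<open>C\<close> at height \<open>inner a b\<close>. It shows that \<open>(- u, - x)\<close> is
    related to the graph; once this pair belongs to the graph, \<open>key\<close> at it forces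
    \<open>x + u = 0\<close>.\<close>
  have key: "inner (x + u) (x + u) \<le> inner (- x - b) (- u - a)" if "b \<in> A a" for a b
  proof -
    have "0 \<le> inner a b - t + inner x (a - x) + inner u (b - u)"
      using zt(2)[OF graph[OF that]] by (simp add: z0)
    then show ?thesis
      using \<open>inner x u \<le> t\<close> by (simp add: inner_add inner_diff inner_commute)
  qed
  have "- x \<in> A (- u)"
    by (rule maximally_monotone_memI[OF A]) (metis key inner_ge_zero order_trans)
  from key[OF this] have "x + u = 0"
    by (simp flip: power2_norm_eq_inner)
  then have "u = - x" by (simp add: add_eq_0_iff)
  then show ?thesis using \<open>- x \<in> A (- u)\<close> by auto
qed

text \<open>\<open>Minty_zero\<close> is applied to \<open>A\<close> scaled by \<open>t\<close> and
  translated by \<open>- w\<close>, which stays maximally monotone.\<close>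

lemma Minty:
  fixes A :: "'a::{real_inner, complete_space} \<Rightarrow> 'a set"
  assumes A: "maximally_monotone A" and "0 < t"
  obtains x a where "a \<in> A x" "x + t *\<^sub>R a = w"
proof -
  let ?A = "\<lambda>y. (\<lambda>a. t *\<^sub>R a - w) ` A y"
  have "maximally_monotone ?A"
    unfolding maximally_monotone_iff
  proof (intro conjI allI impI)
    show "monotone_op ?A"
      using A \<open>0 < t\<close>
      by (auto simp: maximally_monotone_def monotone_op_def simp flip: scaleR_diff_right)
    fix x u assume rel: "\<forall>a. \<forall>b\<in>?A a. 0 \<le> inner (u - b) (x - a)"
    have "(1 / t) *\<^sub>R (u + w) \<in> A x"
    proof (rule maximally_monotone_memI[OF A])
      fix a b assume "b \<in> A a"
      then have "0 \<le> inner (u - (t *\<^sub>R b - w)) (x - a)" using rel by blast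
      also have "u - (t *\<^sub>R b - w) = t *\<^sub>R ((1 / t) *\<^sub>R (u + w) - b)"
        using \<open>0 < t\<close> by (simp add: scaleR_diff_right)
      finally show "0 \<le> inner ((1 / t) *\<^sub>R (u + w) - b) (x - a)"
        using \<open>0 < t\<close> by (simp add: zero_le_mult_iff)
    qed
    then show "u \<in> ?A x" using \<open>0 < t\<close> by (auto simp: image_iff intro!: bexI)
  qed
  from Minty_zero[OF this] obtain x a where "a \<in> A x" "- x = t *\<^sub>R a - w" by auto
  then show thesis using that[of a x] by (simp add: algebra_simps)
qed

section \<open>Resolvents and positive definite operators\<close>

text \<open>A solution is a fixed point of the forward-backward map: a step along
  \<open>w - G x\<close> followed by the resolvent \<open>J\<close> of \<open>A\<close> scaled by
  \<open>t\<close>. Strong monotonicity makes the forward step a contraction and also gives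
  uniqueness.\<close>

lemma ex1_strongly_monotone_plus_maximal:
  fixes A :: "'a::{real_inner, complete_space} \<Rightarrow> 'a set"
  assumes A: "maximally_monotone A" and lip: "L-lipschitz_on UNIV G" and "0 < m"
    and strong: "\<And>x y. m * (norm (x - y))\<^sup>2 \<le> inner (G x - G y) (x - y)"
  shows "\<exists>!x. w - G x \<in> A x"
proof -
  \<comment> \<open>Enlarging \<open>L\<close> to \<open>L'\<close> secures \<open>0 < L'\<close>
    and \<open>m \<le> L'\<close>. The step \<open>t\<close> minimizes
    \<open>1 - 2 * t * m + t\<^sup>2 * L'\<^sup>2\<close>, which bounds the squared contraction
    factor, and \<open>c\<close> is the root of the minimum.\<close>
  define L' where "L' = L + m"
  define t where "t = m / L'\<^sup>2"
  define c where "c = sqrt (1 - m\<^sup>2 / L'\<^sup>2)"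
  have "0 \<le> L" using lip by (rule lipschitz_on_nonneg)
  then have L': "0 < L'" "m \<le> L'" "L \<le> L'" using \<open>0 < m\<close> by (auto simp: L'_def)
  have "0 < t" using \<open>0 < m\<close> L' by (simp add: t_def)
  have ratio: "0 < m\<^sup>2 / L'\<^sup>2" "m\<^sup>2 / L'\<^sup>2 \<le> 1"
    using \<open>0 < m\<close> L' by (auto simp: power_mono)
  then have c: "0 \<le> c" "c < 1" "c\<^sup>2 = 1 - m\<^sup>2 / L'\<^sup>2" by (auto simp: c_def)
  have "\<exists>x a. a \<in> A x \<and> x + t *\<^sub>R a = v" for v
    by (rule Minty[OF A \<open>0 < t\<close>, of v]) blast
  then obtain J a where J: "\<And>v. a v \<in> A (J v)" "\<And>v. J v + t *\<^sub>R a v = v"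
    by metis
  have nonexp: "norm (J v - J v') \<le> norm (v - v')" for v v'
  proof -
    have "v - v' = (J v - J v') + t *\<^sub>R (a v - a v')"
      using J(2)[of v] J(2)[of v'] by (simp add: algebra_simps)
    then have "(norm (v - v'))\<^sup>2 = (norm (J v - J v'))\<^sup>2
        + 2 * t * inner (a v - a v') (J v - J v') + (norm (t *\<^sub>R (a v - a v')))\<^sup>2"
      by (simp only: power2_norm_eq_inner) (simp add: inner_add inner_commute algebra_simps)
    moreover have "0 \<le> 2 * t * inner (a v - a v') (J v - J v')"
      using maximally_monotoneD[OF A J(1) J(1)] \<open>0 < t\<close> by simp
    ultimately have "(norm (J v - J v'))\<^sup>2 \<le> (norm (v - v'))\<^sup>2"
      using zero_le_power2[of "norm (t *\<^sub>R (a v - a v'))"] by linarith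
    then show ?thesis by (rule power2_le_imp_le) simp
  qed
  define T where "T x = J (x - t *\<^sub>R G x + t *\<^sub>R w)" for x
  have "dist (T x) (T y) \<le> c * dist x y" for x y
  proof -
    let ?g = "G x - G y"
    have gL: "norm ?g \<le> L' * norm (x - y)"
      using lipschitz_onD[OF lip, of x y] L'(3) mult_right_mono[OF L'(3), of "norm (x - y)"]
      by (simp add: dist_norm)
    have "norm (T x - T y) \<le> norm ((x - y) - t *\<^sub>R ?g)"
      using nonexp[of "x - t *\<^sub>R G x + t *\<^sub>R w" "y - t *\<^sub>R G y + t *\<^sub>R w"]
      by (simp add: T_def algebra_simps)
    then have "(norm (T x - T y))\<^sup>2 \<le> (norm ((x - y) - t *\<^sub>R ?g))\<^sup>2" by (simp add: power_mono)
    also have "\<dots> = (norm (x - y))\<^sup>2 - 2 * t * inner ?g (x - y) + t\<^sup>2 * (norm ?g)\<^sup>2"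
      by (simp only: power2_norm_eq_inner)
        (simp add: inner_diff inner_commute algebra_simps power2_eq_square)
    also have "\<dots> \<le> (norm (x - y))\<^sup>2 - 2 * t * (m * (norm (x - y))\<^sup>2)
        + t\<^sup>2 * (L' * norm (x - y))\<^sup>2"
      using strong[of x y] \<open>0 < t\<close> gL
      by (intro add_mono diff_mono mult_left_mono power_mono) auto
    also have "\<dots> = (c * norm (x - y))\<^sup>2"
      using L' by (simp only: power_mult_distrib c(3) t_def) (simp add: field_simps power2_eq_square)
    finally show ?thesis
      unfolding dist_norm by (rule power2_le_imp_le) (simp add: c)
  qed
  then obtain x where "T x = x" using banach_fix_type[OF c(1,2), of T] by blast
  then have "x + t *\<^sub>R a (x - t *\<^sub>R G x + t *\<^sub>R w) = x - t *\<^sub>R G x + t *\<^sub>R w"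
    using J(2)[of "x - t *\<^sub>R G x + t *\<^sub>R w"] by (simp add: T_def)
  then have "t *\<^sub>R a (x - t *\<^sub>R G x + t *\<^sub>R w) = t *\<^sub>R (w - G x)" by (simp add: algebra_simps)
  then have "a (x - t *\<^sub>R G x + t *\<^sub>R w) = w - G x" using \<open>0 < t\<close> by simp
  then have ex: "w - G x \<in> A x"
    using J(1)[of "x - t *\<^sub>R G x + t *\<^sub>R w"] \<open>T x = x\<close> by (simp add: T_def)
  have "y = z" if "w - G y \<in> A y" "w - G z \<in> A z" for y z
  proof -
    have "0 \<le> - inner (G y - G z) (y - z)"
      using maximally_monotoneD[OF A that] by (simp add: inner_diff algebra_simps)
    then have "m * (norm (y - z))\<^sup>2 \<le> 0" using strong[of y z] by linarith
    then show ?thesis using \<open>0 < m\<close> by (simp add: mult_le_0_iff)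
  qed
  with ex show ?thesis by blast
qed

lemma maximally_monotone_zero: "maximally_monotone (\<lambda>x::'a::real_inner. {0})"
  unfolding maximally_monotone_iff
proof (intro conjI allI impI)
  fix x u :: 'a assume "\<forall>a. \<forall>b\<in>{0}. 0 \<le> inner (u - b) (x - a)"
  \<comment> \<open>The test point \<open>x + u\<close> turns relatedness into
    \<open>0 \<le> - inner u u\<close>.\<close>
  then have "0 \<le> inner (u - 0) (x - (x + u))" by blast
  then show "u \<in> {0}" by (simp flip: power2_norm_eq_inner)
qed (simp add: monotone_op_def)

section \<open>Norms induced by positive definite operators, and their inverses\<close>

lemma norm_wrt_power2:
  assumes "pos_def_op P"
  shows "(norm_wrt P x)\<^sup>2 = inner x (P x)"
proof -
  obtain l where "0 < l" "\<And>x. l * (norm x)\<^sup>2 \<le> inner x (P x)"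
    using assms by (auto simp: pos_def_op_def)
  then have "0 \<le> inner x (P x)"
    by (meson less_imp_le mult_nonneg_nonneg order_trans zero_le_power2)
  then show ?thesis by (simp add: norm_wrt_def)
qed

lemma norm_wrt_nonneg: "pos_def_op P \<Longrightarrow> 0 \<le> norm_wrt P x"
  using norm_wrt_power2[of P x] unfolding norm_wrt_def
  by (metis real_sqrt_ge_zero zero_le_power2)

lemma norm_wrt_equiv:
  assumes "pos_def_op P"
  obtains c C where "0 < c" "0 < C" "\<And>x. c * norm x \<le> norm_wrt P x" "\<And>x. norm_wrt P x \<le> C * norm x"
proof -
  obtain l u where lu: "0 < l" "l \<le> u" "\<And>x. l * (norm x)\<^sup>2 \<le> inner x (P x)"
    "\<And>x. inner x (P x) \<le> u * (norm x)\<^sup>2"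
    using assms by (auto simp: pos_def_op_def)
  show thesis
  proof (rule that[of "sqrt l" "sqrt u"])
    fix x
    show "sqrt l * norm x \<le> norm_wrt P x" "norm_wrt P x \<le> sqrt u * norm x"
      using real_sqrt_le_mono[OF lu(3)[of x]] real_sqrt_le_mono[OF lu(4)[of x]]
      by (simp_all add: norm_wrt_def real_sqrt_mult)
  qed (use lu in auto)
qed

lemma pos_def_op_inner_commute:
  fixes P :: "'a::{real_inner, complete_space} \<Rightarrow> 'a"
  assumes "pos_def_op P"
  shows "inner (P x) y = inner x (P y)"
  using assms adjoint_inner[of P x y] by (simp add: pos_def_op_def)

lemma bounded_linear_lipschitz:
  assumes "bounded_linear f"
  obtains L where "L-lipschitz_on UNIV f"
proof -
  obtain L where "0 < L" "\<And>x. norm (f x) \<le> norm x * L"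
    using bounded_linear.pos_bounded[OF assms] by blast
  then have "L-lipschitz_on UNIV f"
    by (intro lipschitz_onI)
      (auto simp: dist_norm mult.commute simp flip: linear_diff[OF bounded_linear.linear[OF assms]])
  then show thesis by (rule that)
qed

text \<open>A Lax-Milgram argument: \<open>P\<close> is Lipschitz and strongly monotone, and
  \<open>P x = w\<close> is the inclusion \<open>w - P x \<in> {0}\<close> for the maximally
  monotone zero operator.\<close>

lemma pos_def_op_bij:
  fixes P :: "'a::{real_inner, complete_space} \<Rightarrow> 'a"
  assumes "pos_def_op P"
  shows "bij P"
proof -
  obtain l where l: "0 < l" "\<And>x. l * (norm x)\<^sup>2 \<le> inner x (P x)" and bl: "bounded_linear P"
    using assms by (auto simp: pos_def_op_def)
  obtain L where "L-lipschitz_on UNIV P" using bounded_linear_lipschitz[OF bl] .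
  moreover have "l * (norm (x - y))\<^sup>2 \<le> inner (P x - P y) (x - y)" for x y
    using l(2)[of "x - y"] by (simp add: linear_diff[OF bounded_linear.linear[OF bl]] inner_commute)
  ultimately have "\<exists>!x. w - P x \<in> {0}" for w
    using l(1) by (intro ex1_strongly_monotone_plus_maximal[OF maximally_monotone_zero])
  then show ?thesis unfolding bij_iff by (metis eq_iff_diff_eq_0 singleton_iff)
qed

text \<open>Coercivity of \<open>P\<close> at \<open>inv P v\<close> bounds the inverse by
  \<open>1 / l\<close>. Combined with \<open>norm v \<le> norm (inv P v) * L\<close> it also gives
  the coercivity constant \<open>l / L\<^sup>2\<close>.\<close>

lemma pos_def_op_inv:
  fixes P :: "'a::{real_inner, complete_space} \<Rightarrow> 'a"
  assumes P: "pos_def_op P"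
  shows "pos_def_op (inv P)"
proof -
  obtain l where l: "0 < l" "\<And>x. l * (norm x)\<^sup>2 \<le> inner x (P x)" and bl: "bounded_linear P"
    using P by (auto simp: pos_def_op_def)
  obtain L where L: "0 < L" "\<And>x. norm (P x) \<le> norm x * L"
    using bounded_linear.pos_bounded[OF bl] by blast
  note P_inv = bij_is_surj[OF pos_def_op_bij[OF P], THEN surj_f_inv_f]
  note inv_P = bij_is_inj[OF pos_def_op_bij[OF P], THEN inv_f_f]
  have inv_le: "l * norm (inv P v) \<le> norm v" for v
  proof (cases "inv P v = 0")
    case False
    have "l * (norm (inv P v))\<^sup>2 \<le> inner (inv P v) v" using l(2)[of "inv P v"] by (simp add: P_inv)
    also have "\<dots> \<le> norm (inv P v) * norm v" by (rule norm_cauchy_schwarz)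
    finally show ?thesis using False by (simp add: power2_eq_square)
  qed simp
  have "bounded_linear (inv P)"
  proof (rule bounded_linear_intro)
    fix v w r
    show "inv P (v + w) = inv P v + inv P w"
      by (metis P_inv inv_P linear_add[OF bounded_linear.linear[OF bl]])
    show "inv P (r *\<^sub>R v) = r *\<^sub>R inv P v"
      by (metis P_inv inv_P linear_scale[OF bounded_linear.linear[OF bl]])
    show "norm (inv P v) \<le> norm v * (1 / l)" using inv_le[of v] l(1) by (simp add: field_simps)
  qed
  moreover have "adjoint (inv P) = inv P"
    by (rule adjoint_unique) (metis P_inv pos_def_op_inner_commute[OF P])
  moreover have "l / L\<^sup>2 * (norm v)\<^sup>2 \<le> inner v (inv P v)" for v
  proof -
    have "(norm v)\<^sup>2 \<le> (norm (inv P v) * L)\<^sup>2"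
      using L(2)[of "inv P v"] by (intro power_mono) (auto simp: P_inv)
    then have "l / L\<^sup>2 * (norm v)\<^sup>2 \<le> l / L\<^sup>2 * (norm (inv P v) * L)\<^sup>2"
      using l(1) by (intro mult_left_mono) auto
    also have "\<dots> = l * (norm (inv P v))\<^sup>2" using L(1) by (simp add: power_mult_distrib)
    also have "\<dots> \<le> inner v (inv P v)" using l(2)[of "inv P v"] by (simp add: P_inv inner_commute)
    finally show ?thesis .
  qed
  \<comment> \<open>On the trivial space \<open>l\<close> and \<open>L\<close> are unrelated; the
    maximum keeps the upper constant above the lower one even there.\<close>
  moreover have "inner v (inv P v) \<le> max (l / L\<^sup>2) (1 / l) * (norm v)\<^sup>2" for v
  proof -
    have "inner v (inv P v) \<le> norm v * norm (inv P v)" by (rule norm_cauchy_schwarz)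
    also have "\<dots> \<le> norm v * (1 / l * norm v)"
      using inv_le[of v] l(1) by (intro mult_left_mono) (auto simp: field_simps)
    also have "\<dots> = 1 / l * (norm v)\<^sup>2" by (simp add: power2_eq_square)
    also have "\<dots> \<le> max (l / L\<^sup>2) (1 / l) * (norm v)\<^sup>2" by (intro mult_right_mono) auto
    finally show ?thesis .
  qed
  moreover have "0 < l / L\<^sup>2" using l(1) L(1) by simp
  ultimately show ?thesis unfolding pos_def_op_def by (meson max.cobounded1)
qed

section \<open>Fejer monotone sequences\<close>

text \<open>
  The functionals \<open>inner (x k)\<close> live in a product of compact intervals, so Tychonoff's theorem
  gives a cluster point, which is again linear and bounded, hence represented by a vector.
\<close>

lemma bounded_weak_cluster:
  fixes x :: "'i \<Rightarrow> 'a::{real_inner, complete_space}"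
  assumes "F \<noteq> bot" and bd: "\<And>k. norm (x k) \<le> R"
  shows "\<exists>G p. G \<noteq> bot \<and> G \<le> F \<and> (\<forall>y. ((\<lambda>k. inner (x k) y) \<longlongrightarrow> inner p y) G)"
proof -
  define \<Phi> where "\<Phi> k = inner (x k)" for k
  let ?K = "PiE UNIV (\<lambda>y::'a. cball (0::real) (R * norm y))"
  have "compact ?K"
    using compactin_PiE[of "\<lambda>_::'a. euclidean :: real topology" UNIV "\<lambda>y. cball 0 (R * norm y)"]
    by (simp add: euclidean_product_topology)
  have \<Phi>_le: "\<bar>\<Phi> k y\<bar> \<le> R * norm y" for k y
    using Cauchy_Schwarz_ineq2[of "x k" y] mult_right_mono[OF bd, of "norm y" k]
    by (simp add: \<Phi>_def)
  then have "eventually (\<lambda>f. f \<in> ?K) (filtermap \<Phi> F)"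
    by (simp add: eventually_filtermap PiE_UNIV_domain)
  moreover have "filtermap \<Phi> F \<noteq> bot" using \<open>F \<noteq> bot\<close> by (simp add: filtermap_bot_iff)
  ultimately obtain \<phi> where \<phi>: "\<phi> \<in> ?K" "inf (nhds \<phi>) (filtermap \<Phi> F) \<noteq> bot"
    using \<open>compact ?K\<close> unfolding compact_filter by blast
  \<comment> \<open>\<open>G\<close> acts as a convergent subnet: it refines \<open>F\<close> by the
    preimages of neighbourhoods of the cluster point \<open>\<phi>\<close>, so \<open>\<Phi>\<close>
    tends to \<open>\<phi>\<close> along it.\<close>
  define G where "G = inf F (filtercomap \<Phi> (nhds \<phi>))"
  have "G \<noteq> bot"
  proof
    assume "G = bot"
    then have "eventually (\<lambda>_. False) G" by simp
    then obtain P Q where PQ: "eventually P F" "eventually Q (filtercomap \<Phi> (nhds \<phi>))"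
      "\<And>k. P k \<Longrightarrow> Q k \<Longrightarrow> False"
      unfolding G_def eventually_inf by blast
    then obtain W where W: "eventually W (nhds \<phi>)" "\<And>k. W (\<Phi> k) \<Longrightarrow> Q k"
      unfolding eventually_filtercomap by blast
    have "eventually (\<lambda>f. \<not> W f) (filtermap \<Phi> F)"
      unfolding eventually_filtermap using PQ(1) by (rule eventually_mono) (use PQ(3) W(2) in blast)
    with W(1) have "eventually (\<lambda>_. False) (inf (nhds \<phi>) (filtermap \<Phi> F))"
      unfolding eventually_inf by blast
    then show False using \<phi>(2) by (simp add: trivial_limit_def)
  qed
  have "G \<le> F" by (simp add: G_def)
  have "filterlim \<Phi> (nhds \<phi>) G"
    unfolding G_def by (rule filterlim_mono[OF filterlim_filtercomap]) auto
  then have lim: "((\<lambda>k. \<Phi> k y) \<longlongrightarrow> \<phi> y) G" for y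
    using continuous_on_tendsto_compose[OF continuous_on_product_coordinates] by fastforce
  have "bounded_linear \<phi>"
  proof (rule bounded_linear_intro)
    fix y z r
    have "((\<lambda>k. \<Phi> k (y + z)) \<longlongrightarrow> \<phi> y + \<phi> z) G"
      using tendsto_add[OF lim[of y] lim[of z]] by (simp add: \<Phi>_def inner_add_right)
    then show "\<phi> (y + z) = \<phi> y + \<phi> z" using tendsto_unique[OF \<open>G \<noteq> bot\<close> lim] by blast
    have "((\<lambda>k. \<Phi> k (r *\<^sub>R y)) \<longlongrightarrow> r * \<phi> y) G"
      using tendsto_mult[OF tendsto_const lim[of y], of r] by (simp add: \<Phi>_def)
    then show "\<phi> (r *\<^sub>R y) = r *\<^sub>R \<phi> y"
      using tendsto_unique[OF \<open>G \<noteq> bot\<close> lim] by (metis real_scaleR_def)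
    show "norm (\<phi> y) \<le> norm y * R"
      using \<phi>(1) by (auto simp: PiE_UNIV_domain Pi_iff mult.commute)
  qed
  then obtain p where "\<And>y. \<phi> y = inner p y"
    using Riesz_representation by blast
  then have "((\<lambda>k. inner (x k) y) \<longlongrightarrow> inner p y) G" for y
    using lim[of y] by (simp add: \<Phi>_def)
  then show ?thesis using \<open>G \<noteq> bot\<close> \<open>G \<le> F\<close> by blast
qed

lemma Fejer_bounded:
  fixes x :: "nat \<Rightarrow> 'a::real_inner"
  assumes S: "pos_def_op S"
    and fejer: "\<And>k. norm_wrt S (x (Suc k) - z) \<le> norm_wrt S (x k - z)"
  shows "\<exists>R. \<forall>k. norm (x k) \<le> R"
proof -
  have decr: "decseq (\<lambda>k. norm_wrt S (x k - z))" using fejer by (simp add: decseq_Suc_iff)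
  obtain c C where "0 < C" "\<And>v. norm_wrt S v \<le> C * norm v"
    and c: "0 < c" "\<And>v. c * norm v \<le> norm_wrt S v"
    using norm_wrt_equiv[OF S] by metis
  have "norm (x k) \<le> norm z + norm_wrt S (x 0 - z) / c" for k
  proof -
    have "c * norm (x k - z) \<le> norm_wrt S (x 0 - z)"
      using c(2)[of "x k - z"] decseqD[OF decr, of 0 k] by simp
    then have "norm (x k - z) \<le> norm_wrt S (x 0 - z) / c" using c(1) by (simp add: field_simps)
    then show ?thesis using norm_triangle_sub[of "x k" z] by linarith
  qed
  then show ?thesis by blast
qed

text \<open>The squared \<open>S\<close>-distances to two weak cluster points \<open>p\<close> and
  \<open>q\<close> both converge and their difference is affine in \<open>x k\<close>. So
  \<open>inner (x k) (S (p - q))\<close> has a single limit, which forces \<open>p = q\<close>.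
  Clustering is along filters because compactness provides filters rather than subsequences.\<close>

lemma Opial:
  fixes x :: "nat \<Rightarrow> 'a::{real_inner, complete_space}"
  assumes S: "pos_def_op S" and "Z \<noteq> {}"
    and fejer: "\<And>z k. z \<in> Z \<Longrightarrow> norm_wrt S (x (Suc k) - z) \<le> norm_wrt S (x k - z)"
    and cluster: "\<And>G p. G \<noteq> bot \<Longrightarrow> G \<le> sequentially \<Longrightarrow>
      (\<And>y. ((\<lambda>k. inner (x k) y) \<longlongrightarrow> inner p y) G) \<Longrightarrow> p \<in> Z"
  shows "\<exists>p\<in>Z. weakly_converges_to x p"
proof -
  have bl: "bounded_linear S" using S by (simp add: pos_def_op_def)
  note S_diff = linear_diff[OF bounded_linear.linear[OF bl]]
  note S_comm = pos_def_op_inner_commute[OF S]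
  have decr: "decseq (\<lambda>k. norm_wrt S (x k - z))" if "z \<in> Z" for z
    using fejer[OF that] by (simp add: decseq_Suc_iff)
  obtain z0 where "z0 \<in> Z" using \<open>Z \<noteq> {}\<close> by blast
  obtain c C where "0 < C" "\<And>v. norm_wrt S v \<le> C * norm v"
    and c: "0 < c" "\<And>v. c * norm v \<le> norm_wrt S v"
    using norm_wrt_equiv[OF S] by metis
  obtain R where bd: "\<And>k. norm (x k) \<le> R"
    using Fejer_bounded[where x = x, OF S fejer[OF \<open>z0 \<in> Z\<close>]] by blast
  have lim: "convergent (\<lambda>k. (norm_wrt S (x k - z))\<^sup>2)" if "z \<in> Z" for z
  proof -
    obtain l where "(\<lambda>k. norm_wrt S (x k - z)) \<longlonglongrightarrow> l"
      using decseq_convergent[OF decr[OF \<open>z \<in> Z\<close>], of 0] norm_wrt_nonneg[OF S] by blast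
    then have "(\<lambda>k. (norm_wrt S (x k - z))\<^sup>2) \<longlonglongrightarrow> l\<^sup>2" by (rule tendsto_power)
    then show ?thesis by (rule convergentI)
  qed
  have unique: "p = q"
    if G: "G \<noteq> bot" "G \<le> sequentially" "\<And>y. ((\<lambda>k. inner (x k) y) \<longlongrightarrow> inner p y) G"
      and H: "H \<noteq> bot" "H \<le> sequentially" "\<And>y. ((\<lambda>k. inner (x k) y) \<longlongrightarrow> inner q y) H"
    for G H p q
  proof -
    have "p \<in> Z" "q \<in> Z" using cluster G H by blast+
    have "inner (x k) (S (p - q)) =
        ((norm_wrt S (x k - q))\<^sup>2 - (norm_wrt S (x k - p))\<^sup>2 + inner p (S p) - inner q (S q)) / 2" for k
      using S_comm[of p "x k"] S_comm[of q "x k"]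
      by (simp add: norm_wrt_power2[OF S] S_diff inner_diff inner_commute)
    moreover obtain r s where "(\<lambda>k. (norm_wrt S (x k - p))\<^sup>2) \<longlonglongrightarrow> r" "(\<lambda>k. (norm_wrt S (x k - q))\<^sup>2) \<longlonglongrightarrow> s"
      using lim[OF \<open>p \<in> Z\<close>] lim[OF \<open>q \<in> Z\<close>] unfolding convergent_def by blast
    then have "(\<lambda>k.
        ((norm_wrt S (x k - q))\<^sup>2 - (norm_wrt S (x k - p))\<^sup>2 + inner p (S p) - inner q (S q)) / 2)
        \<longlonglongrightarrow> (s - r + inner p (S p) - inner q (S q)) / 2"
      by (intro tendsto_divide tendsto_add tendsto_diff tendsto_const) auto
    ultimately obtain l where l: "(\<lambda>k. inner (x k) (S (p - q))) \<longlonglongrightarrow> l"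
      by auto
    have "l = inner p (S (p - q))" "l = inner q (S (p - q))"
      using tendsto_unique[OF G(1) tendsto_mono[OF G(2) l] G(3)]
        tendsto_unique[OF H(1) tendsto_mono[OF H(2) l] H(3)] by auto
    then have "(norm_wrt S (p - q))\<^sup>2 = 0"
      by (simp add: norm_wrt_power2[OF S] inner_diff_left)
    then show ?thesis using c(1) c(2)[of "p - q"] by (simp add: mult_le_0_iff)
  qed
  obtain G p where G: "G \<noteq> bot" "G \<le> sequentially" "\<And>y. ((\<lambda>k. inner (x k) y) \<longlongrightarrow> inner p y) G"
    using bounded_weak_cluster[where x = x, OF sequentially_bot bd] by blast
  have "(\<lambda>k. inner (x k) y) \<longlonglongrightarrow> inner p y" for y
  proof (rule ccontr)
    assume "\<not> ?thesis"
    then obtain e where e: "0 < e" "\<not> (\<forall>\<^sub>F k in sequentially. dist (inner (x k) y) (inner p y) < e)"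
      unfolding tendsto_iff by blast
    \<comment> \<open>\<open>F\<close> keeps only indices at which the iterates stay away from
      \<open>p\<close> in direction \<open>y\<close>; a cluster point along it must still be
      \<open>p\<close>, a contradiction.\<close>
    define F where "F = inf sequentially (principal {k. \<not> dist (inner (x k) y) (inner p y) < e})"
    have "F \<noteq> bot" using e(2) by (simp add: F_def trivial_limit_def eventually_inf_principal)
    obtain H q where H: "H \<noteq> bot" "H \<le> F" "\<And>y. ((\<lambda>k. inner (x k) y) \<longlongrightarrow> inner q y) H"
      using bounded_weak_cluster[where x = x, OF \<open>F \<noteq> bot\<close> bd] by blast
    have "H \<le> sequentially" using H(2) by (simp add: F_def)
    then have "p = q" using unique[OF G H(1) _ H(3)] by blast
    then have "\<forall>\<^sub>F k in H. dist (inner (x k) y) (inner p y) < e"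
      using H(3)[of y] e(1) by (simp add: tendsto_iff)
    moreover have "\<forall>\<^sub>F k in H. \<not> dist (inner (x k) y) (inner p y) < e"
      using H(2) by (rule filter_leD) (simp add: F_def eventually_inf_principal)
    ultimately have "\<forall>\<^sub>F k in H. False" by eventually_elim blast
    then show False using H(1) by (simp add: trivial_limit_def)
  qed
  then show ?thesis using cluster[OF G] by (auto simp: weakly_converges_to_def)
qed

text \<open>A finite orthogonal spanning set expresses every vector through finitely many inner
  products, and those converge.\<close>

lemma weakly_convergent_finite_dimensional:
  fixes x :: "nat \<Rightarrow> 'a::real_inner"
  assumes "finite_dimensional TYPE('a)" and weak: "weakly_converges_to x p"
  shows "x \<longlonglongrightarrow> p"
proof -
  obtain X :: "'a set" where "finite X" "span X = UNIV"
    using assms(1) by (auto simp: finite_dimensional_def)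
  then obtain C :: "'a set" where C: "finite C" "span C = UNIV" "pairwise orthogonal C"
    using basis_orthogonal[OF \<open>finite X\<close>] by metis
  \<comment> \<open>The residual is orthogonal to \<open>C\<close> and lies in its span, so it
    vanishes. A zero vector in \<open>C\<close> does no harm, since division by zero yields
    \<open>0\<close>.\<close>
  have expand: "v = (\<Sum>c\<in>C. (inner v c / inner c c) *\<^sub>R c)" for v
  proof -
    let ?r = "v - (\<Sum>c\<in>C. (inner v c / inner c c) *\<^sub>R c)"
    have "inner c ?r = 0" if "c \<in> C" for c
    proof -
      have "inner c (\<Sum>d\<in>C. (inner v d / inner d d) *\<^sub>R d)
          = (\<Sum>d\<in>C. (inner v d / inner d d) * inner c d)"
        by (simp add: inner_sum_right)
      also have "\<dots> = (\<Sum>d\<in>C. if d = c then (inner v c / inner c c) * inner c c else 0)"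
        using C(3) that by (intro sum.cong) (auto simp: pairwise_def orthogonal_def)
      also have "\<dots> = inner c v" using C(1) that by (auto simp: inner_commute)
      finally show ?thesis by (simp add: inner_diff_right)
    qed
    then have "orthogonal ?r c" if "c \<in> C" for c using that by (simp add: orthogonal_def inner_commute)
    moreover have "?r \<in> span C" using C(2) by simp
    ultimately have "orthogonal ?r ?r" by (rule orthogonal_to_span[rotated])
    then show ?thesis by (simp add: orthogonal_def)
  qed
  have "(\<lambda>k. \<Sum>c\<in>C. (inner (x k) c / inner c c) *\<^sub>R c) \<longlonglongrightarrow> (\<Sum>c\<in>C. (inner p c / inner c c) *\<^sub>R c)"
    using weak unfolding weakly_converges_to_def divide_inverse
    by (intro tendsto_sum tendsto_scaleR tendsto_mult_right tendsto_const) auto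
  then show ?thesis by (simp flip: expand)
qed

section \<open>Distances to the target set and linear rates\<close>

lemma dist_wrt_eq_INF:
  assumes "pos_def_op S" "Z \<noteq> {}"
  shows "dist_wrt S x Z = ereal (INF z\<in>Z. norm_wrt S (x - z))"
proof -
  have "bdd_below ((\<lambda>z. norm_wrt S (x - z)) ` Z)"
    by (rule bdd_belowI2[of _ 0]) (rule norm_wrt_nonneg[OF assms(1)])
  then show ?thesis using assms(2) by (simp add: dist_wrt_def ereal_Inf' image_comp)
qed

text \<open>The Q-linear rate is the contraction \<open>dist_Suc\<close>. For the R-linear rate,
  Fejer monotonicity bounds the distance from \<open>x k\<close> to every later iterate by a
  multiple of its distance to any \<open>z \<in> Z\<close>; in the limit the distance to
  \<open>p\<close> is at most a multiple of \<open>d k\<close>, which decays geometrically.\<close>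

lemma Fejer_linear_convergence:
  fixes x :: "nat \<Rightarrow> 'a::{real_inner, complete_space}"
  assumes S: "pos_def_op S" and "p \<in> Z" and "x \<longlonglongrightarrow> p"
    and fejer: "\<And>z k. z \<in> Z \<Longrightarrow> norm_wrt S (x (Suc k) - z) \<le> norm_wrt S (x k - z)"
    and "c < 1" and dist_Suc: "\<And>k. k \<ge> K0 \<Longrightarrow>
      (INF z\<in>Z. norm_wrt S (x (Suc k) - z)) \<le> c * (INF z\<in>Z. norm_wrt S (x k - z))"
  shows "locally_R_linear S x p" "locally_Q_linear (\<lambda>k. dist_wrt S (x k) Z)"
proof -
  define d where "d k = (INF z\<in>Z. norm_wrt S (x k - z))" for k
  \<comment> \<open>\<open>c\<close> may be zero or negative, whereas the final constant divides by
    \<open>q ^ K0\<close>.\<close>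
  define q where "q = max c (1/2)"
  have q: "0 < q" "q < 1" "c \<le> q" using \<open>c < 1\<close> by (auto simp: q_def)
  have "Z \<noteq> {}" using \<open>p \<in> Z\<close> by blast
  have d_nonneg: "0 \<le> d k" for k
    unfolding d_def by (intro cINF_greatest norm_wrt_nonneg[OF S] \<open>Z \<noteq> {}\<close>)
  have d_Suc: "d (Suc k) \<le> q * d k" if "k \<ge> K0" for k
    using dist_Suc[OF that] mult_right_mono[OF q(3) d_nonneg[of k]] by (simp add: d_def)
  have d_eq: "dist_wrt S (x k) Z = ereal (d k)" for k
    unfolding d_def by (rule dist_wrt_eq_INF[OF S \<open>Z \<noteq> {}\<close>])
  show "locally_Q_linear (\<lambda>k. dist_wrt S (x k) Z)"
    unfolding locally_Q_linear_def d_eq using d_nonneg d_Suc q by (auto intro!: exI[of _ K0] exI[of _ q])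
  have d_pow: "d k \<le> d K0 * q ^ (k - K0)" if "k \<ge> K0" for k
    using that
  proof (induction rule: dec_induct)
    case (step k)
    have "d (Suc k) \<le> q * (d K0 * q ^ (k - K0))"
      using d_Suc[OF step.hyps(1)] mult_left_mono[OF step.IH, of q] q by linarith
    then show ?case using step.hyps by (simp add: Suc_diff_le mult_ac)
  qed simp
  obtain a b where ab: "0 < a" "0 < b" "\<And>v. a * norm v \<le> norm_wrt S v" "\<And>v. norm_wrt S v \<le> b * norm v"
    using norm_wrt_equiv[OF S] by blast
  have near: "norm_wrt S (x k - p) \<le> 2 * b / a * norm_wrt S (x k - z)" if "z \<in> Z" for k z
  proof -
    have "norm (x k - x n) \<le> 2 / a * norm_wrt S (x k - z)" if "n \<ge> k" for n
    proof -
      have "decseq (\<lambda>k. norm_wrt S (x k - z))" using fejer[OF \<open>z \<in> Z\<close>] by (simp add: decseq_Suc_iff)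
      then have "norm_wrt S (x n - z) \<le> norm_wrt S (x k - z)" using that by (auto dest: decseqD)
      then have "a * norm (x n - z) \<le> norm_wrt S (x k - z)" "a * norm (x k - z) \<le> norm_wrt S (x k - z)"
        using ab(3)[of "x n - z"] ab(3)[of "x k - z"] by linarith+
      then have "a * (norm (x k - z) + norm (x n - z)) \<le> 2 * norm_wrt S (x k - z)"
        by (simp add: distrib_left)
      moreover have "norm (x k - x n) \<le> norm (x k - z) + norm (x n - z)"
        using dist_triangle2[of "x k" "x n" z] by (simp add: dist_norm)
      ultimately have "a * norm (x k - x n) \<le> 2 * norm_wrt S (x k - z)"
        using ab(1) by (meson less_imp_le mult_left_mono order_trans)
      then show ?thesis using ab(1) by (simp add: field_simps)
    qed
    moreover have "(\<lambda>n. norm (x k - x n)) \<longlonglongrightarrow> norm (x k - p)"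
      by (intro tendsto_norm tendsto_diff tendsto_const \<open>x \<longlonglongrightarrow> p\<close>)
    ultimately have "norm (x k - p) \<le> 2 / a * norm_wrt S (x k - z)"
      by (intro LIMSEQ_le_const2) auto
    then have "b * norm (x k - p) \<le> b * (2 / a * norm_wrt S (x k - z))"
      by (intro mult_left_mono less_imp_le[OF ab(2)])
    then show ?thesis using ab(4)[of "x k - p"] by (simp add: mult_ac)
  qed
  have near_d: "norm_wrt S (x k - p) \<le> 2 * b / a * d k" for k
  proof -
    have "norm_wrt S (x k - p) / (2 * b / a) \<le> d k"
      unfolding d_def using near[of _ k] ab(1,2) by (intro cINF_greatest \<open>Z \<noteq> {}\<close>) (simp add: field_simps)
    then show ?thesis using ab(1,2) by (simp add: field_simps)
  qed
  have "norm_wrt S (x k - p) \<le> 2 * b / a * d K0 / q ^ K0 * q ^ k" if "k \<ge> K0" for k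
  proof -
    have "norm_wrt S (x k - p) \<le> 2 * b / a * (d K0 * q ^ (k - K0))"
      using near_d[of k] mult_left_mono[OF d_pow[OF that], of "2 * b / a"] ab(1,2) by simp
    also have "\<dots> = 2 * b / a * d K0 / q ^ K0 * q ^ k"
      using q that by (simp add: power_diff)
    finally show ?thesis .
  qed
  then show "locally_R_linear S x p"
    unfolding locally_R_linear_def using q d_nonneg[of K0] ab(1,2)
    by (intro exI[of _ K0] exI[of _ "2 * b / a * d K0 / q ^ K0"] exI[of _ q]) auto
qed

text \<open>The squared distances decrease and are bounded below, so their consecutive differences,
  which dominate \<open>\<rho> * (norm (e k))\<^sup>2\<close>, tend to zero.\<close>

lemma Fejer_increments_tendsto_zero:
  fixes x e :: "nat \<Rightarrow> 'a::real_inner"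
  assumes S: "pos_def_op S" and "0 < \<rho>"
    and descent: "\<And>k. (norm_wrt S (x (Suc k) - z))\<^sup>2 \<le>
      (norm_wrt S (x k - z))\<^sup>2 - \<rho> * (norm (e k))\<^sup>2"
  shows "e \<longlonglongrightarrow> 0"
proof -
  define a where "a k = (norm_wrt S (x k - z))\<^sup>2" for k
  have le: "\<rho> * (norm (e k))\<^sup>2 \<le> a k - a (Suc k)" for k
    using descent[of k] by (simp add: a_def)
  have "a (Suc k) \<le> a k" for k
  proof -
    have "0 \<le> \<rho> * (norm (e k))\<^sup>2" using \<open>0 < \<rho>\<close> by simp
    then show ?thesis using le[of k] by linarith
  qed
  then have "decseq a" by (simp add: decseq_Suc_iff)
  moreover have "\<forall>k. 0 \<le> a k" by (simp add: a_def)
  ultimately obtain l where l: "a \<longlonglongrightarrow> l" by (rule decseq_convergent)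
  have "(\<lambda>k. (a k - a (Suc k)) / \<rho>) \<longlonglongrightarrow> (l - l) / \<rho>"
    using \<open>0 < \<rho>\<close> by (intro tendsto_divide tendsto_diff tendsto_const l LIMSEQ_Suc[OF l]) auto
  then have lim0: "(\<lambda>k. (a k - a (Suc k)) / \<rho>) \<longlonglongrightarrow> 0" by simp
  have "(\<lambda>k. (norm (e k))\<^sup>2) \<longlonglongrightarrow> 0"
  proof (rule tendsto_sandwich[OF _ _ tendsto_const lim0])
    show "\<forall>\<^sub>F k in sequentially. (norm (e k))\<^sup>2 \<le> (a k - a (Suc k)) / \<rho>"
      using le \<open>0 < \<rho>\<close> by (intro always_eventually allI) (simp add: pos_le_divide_eq mult.commute)
  qed simp
  from tendsto_real_sqrt[OF this] show ?thesis by (simp add: tendsto_norm_zero_iff)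
qed

text \<open>Taking the infimum over \<open>z\<close> turns \<open>descent\<close> into the same
  inequality for the distance to \<open>Z\<close>. The error bound then replaces
  \<open>norm (e k)\<close> by a fraction of that distance, which gives a contraction.\<close>

lemma Fejer_descent_linear_convergence:
  fixes x e :: "nat \<Rightarrow> 'a::{real_inner, complete_space}"
  assumes S: "pos_def_op S" and "p \<in> Z" and "x \<longlonglongrightarrow> p" and "0 < \<rho>"
    and descent: "\<And>z k. z \<in> Z \<Longrightarrow> (norm_wrt S (x (Suc k) - z))\<^sup>2 \<le>
      (norm_wrt S (x k - z))\<^sup>2 - \<rho> * (norm (e k))\<^sup>2"
    and error_bound: "\<And>k. k \<ge> K0 \<Longrightarrow> (INF z\<in>Z. norm_wrt S (x k - z)) \<le> C * norm (e k)"
  shows "locally_R_linear S x p" "locally_Q_linear (\<lambda>k. dist_wrt S (x k) Z)"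
proof -
  define d where "d k = (INF z\<in>Z. norm_wrt S (x k - z))" for k
  \<comment> \<open>The two maxima keep the divisor positive and the radicand of \<open>c\<close>
    nonnegative: \<open>C\<close> may be nonpositive and \<open>\<rho>\<close> may exceed
    \<open>C'\<^sup>2\<close>.\<close>
  define C' where "C' = max C 1"
  define c where "c = sqrt (max 0 (1 - \<rho> / C'\<^sup>2))"
  have "Z \<noteq> {}" using \<open>p \<in> Z\<close> by blast
  have "0 < C'" "C \<le> C'" by (auto simp: C'_def)
  have d_nonneg: "0 \<le> d k" for k
    unfolding d_def by (intro cINF_greatest norm_wrt_nonneg[OF S] \<open>Z \<noteq> {}\<close>)
  have d_le: "d k \<le> norm_wrt S (x k - z)" if "z \<in> Z" for k z
    unfolding d_def
    by (rule cINF_lower[OF bdd_belowI2[of _ 0] that]) (rule norm_wrt_nonneg[OF S])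
  have sq: "(d (Suc k))\<^sup>2 + \<rho> * (norm (e k))\<^sup>2 \<le> (d k)\<^sup>2" for k
  proof -
    \<comment> \<open>Under the root the bound concerns unsquared distances, so it passes directly
      to the infimum \<open>d k\<close>.\<close>
    have "sqrt ((d (Suc k))\<^sup>2 + \<rho> * (norm (e k))\<^sup>2) \<le> norm_wrt S (x k - z)" if "z \<in> Z" for z
    proof (rule real_le_lsqrt)
      show "0 \<le> norm_wrt S (x k - z)" by (rule norm_wrt_nonneg[OF S])
      have "(d (Suc k))\<^sup>2 \<le> (norm_wrt S (x (Suc k) - z))\<^sup>2"
        using d_le[OF that] d_nonneg by (rule power_mono)
      then show "(d (Suc k))\<^sup>2 + \<rho> * (norm (e k))\<^sup>2 \<le> (norm_wrt S (x k - z))\<^sup>2"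
        using descent[OF that, of k] by linarith
    qed
    then have "sqrt ((d (Suc k))\<^sup>2 + \<rho> * (norm (e k))\<^sup>2) \<le> d k"
      unfolding d_def[of k] by (intro cINF_greatest \<open>Z \<noteq> {}\<close>)
    then show ?thesis by (rule sqrt_le_D)
  qed
  have "d (Suc k) \<le> c * d k" if "k \<ge> K0" for k
  proof -
    have "d k \<le> C' * norm (e k)"
      using error_bound[OF that] mult_right_mono[OF \<open>C \<le> C'\<close>, of "norm (e k)"] by (simp add: d_def)
    then have "(d k)\<^sup>2 \<le> (C' * norm (e k))\<^sup>2" using d_nonneg by (rule power_mono)
    then have "(d k)\<^sup>2 / C'\<^sup>2 \<le> (norm (e k))\<^sup>2"
      using \<open>0 < C'\<close> by (simp add: field_simps power_mult_distrib)
    then have "\<rho> * ((d k)\<^sup>2 / C'\<^sup>2) \<le> \<rho> * (norm (e k))\<^sup>2"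
      by (rule mult_left_mono[OF _ less_imp_le[OF \<open>0 < \<rho>\<close>]])
    then have "(d (Suc k))\<^sup>2 \<le> (1 - \<rho> / C'\<^sup>2) * (d k)\<^sup>2" using sq[of k] by (simp add: algebra_simps)
    also have "\<dots> \<le> max 0 (1 - \<rho> / C'\<^sup>2) * (d k)\<^sup>2" by (intro mult_right_mono) auto
    also have "\<dots> = (c * d k)\<^sup>2" by (simp add: c_def power_mult_distrib)
    finally show ?thesis by (rule power2_le_imp_le) (simp add: c_def d_nonneg)
  qed
  moreover have "c < 1" using \<open>0 < \<rho>\<close> \<open>0 < C'\<close> by (simp add: c_def)
  moreover have "norm_wrt S (x (Suc k) - z) \<le> norm_wrt S (x k - z)" if "z \<in> Z" for z k
  proof (rule power2_le_imp_le[OF _ norm_wrt_nonneg[OF S]])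
    have "0 \<le> \<rho> * (norm (e k))\<^sup>2" using \<open>0 < \<rho>\<close> by simp
    then show "(norm_wrt S (x (Suc k) - z))\<^sup>2 \<le> (norm_wrt S (x k - z))\<^sup>2"
      using descent[OF that, of k] by linarith
  qed
  ultimately show "locally_R_linear S x p" "locally_Q_linear (\<lambda>k. dist_wrt S (x k) Z)"
    using Fejer_linear_convergence[OF S \<open>p \<in> Z\<close> \<open>x \<longlonglongrightarrow> p\<close>, of c K0] unfolding d_def by blast+
qed

section \<open>The splitting method\<close>

lemma inv_cocoercive_wrt_monotone:
  assumes "pos_def_op P" "0 \<le> \<beta>" "inv_cocoercive_wrt P \<beta> E"
  shows "0 \<le> inner (E x - E y) (x - y)"
proof (cases "\<beta> = 0")
  case False
  then have "1 / \<beta> * (norm_wrt (inv P) (E x - E y))\<^sup>2 \<le> inner (E x - E y) (x - y)"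
    using assms(3) by (simp add: inv_cocoercive_wrt_def)
  moreover have "0 \<le> 1 / \<beta> * (norm_wrt (inv P) (E x - E y))\<^sup>2" using assms(2) by simp
  ultimately show ?thesis by linarith
next
  case True
  then have "E x = E y" using assms(3) by (simp add: inv_cocoercive_wrt_def)
  then show ?thesis by simp
qed

text \<open>Cocoercivity with Cauchy-Schwarz bounds a multiple of the squared norm of
  \<open>E x - E y\<close> by that norm times \<open>norm (x - y)\<close>; one factor
  cancels.\<close>

lemma inv_cocoercive_wrt_lipschitz:
  fixes P :: "'a::{real_inner, complete_space} \<Rightarrow> 'a"
  assumes P: "pos_def_op P" and "0 \<le> \<beta>" and coco: "inv_cocoercive_wrt P \<beta> E"
  shows "\<exists>L. L-lipschitz_on UNIV E"
proof (cases "\<beta> = 0")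
  case True
  then have "E x = E y" for x y using coco by (simp add: inv_cocoercive_wrt_def)
  then have "0-lipschitz_on UNIV E" by (intro lipschitz_onI) auto
  then show ?thesis by blast
next
  case False
  then have "0 < \<beta>" using \<open>0 \<le> \<beta>\<close> by simp
  obtain c C where "0 < C" "\<And>v. norm_wrt (inv P) v \<le> C * norm v"
    and c: "0 < c" "\<And>v. c * norm v \<le> norm_wrt (inv P) v"
    using norm_wrt_equiv[OF pos_def_op_inv[OF P]] by metis
  have "norm (E x - E y) \<le> \<beta> / c\<^sup>2 * norm (x - y)" for x y
  proof (cases "E x = E y")
    case False
    let ?g = "E x - E y"
    have "(c * norm ?g)\<^sup>2 \<le> (norm_wrt (inv P) ?g)\<^sup>2"
      using c by (intro power_mono) auto
    also have "\<dots> \<le> \<beta> * inner ?g (x - y)"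
      using coco \<open>0 < \<beta>\<close> by (simp add: inv_cocoercive_wrt_def field_simps)
    also have "\<dots> \<le> \<beta> * (norm ?g * norm (x - y))"
      using \<open>0 < \<beta>\<close> by (intro mult_left_mono norm_cauchy_schwarz) auto
    finally have "norm ?g * (c\<^sup>2 * norm ?g) \<le> norm ?g * (\<beta> * norm (x - y))"
      by (simp add: power2_eq_square mult_ac)
    then have "c\<^sup>2 * norm ?g \<le> \<beta> * norm (x - y)" using False by simp
    then show ?thesis using c(1) by (simp add: field_simps)
  qed (use \<open>0 \<le> \<beta>\<close> in simp)
  then have "(\<beta> / c\<^sup>2)-lipschitz_on UNIV E"
    using \<open>0 \<le> \<beta>\<close> by (intro lipschitz_onI) (auto simp: dist_norm)
  then show ?thesis by blast
qed

text \<open>Young's inequality for the dual norms of \<open>P\<close> and \<open>inv P\<close>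
  splits the pairing of \<open>E x - E z\<close> with \<open>x - w\<close>; cocoercivity absorbs the
  dual term. This is the origin of \<open>\<beta> / 4\<close> in the numerator of the step
  size.\<close>

lemma inv_cocoercive_wrt_three_point:
  fixes P :: "'a::{real_inner, complete_space} \<Rightarrow> 'a"
  assumes P: "pos_def_op P" and "0 \<le> \<beta>" and coco: "inv_cocoercive_wrt P \<beta> E"
  shows "- (\<beta> / 4) * (norm_wrt P (x - w))\<^sup>2 \<le> inner (E x - E z) (w - z)"
proof (cases "\<beta> = 0")
  case True
  then have "E x = E z" using coco by (simp add: inv_cocoercive_wrt_def)
  then show ?thesis using True by simp
next
  case False
  then have "0 < \<beta>" using \<open>0 \<le> \<beta>\<close> by simp
  have P_inv: "P (inv P v) = v" for v
    by (rule surj_f_inv_f[OF bij_is_surj[OF pos_def_op_bij[OF P]]])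
  have lin: "linear P" using P by (simp add: pos_def_op_def bounded_linear.linear)
  define s where "s = inv P (E x - E z)"
  have Ps: "P s = E x - E z" by (simp add: s_def P_inv)
  define v where "v = x - w"
  \<comment> \<open>Young's inequality is the nonnegativity of \<open>inner h (P h)\<close>, with
    \<open>\<beta> / 2\<close> balancing the two squares.\<close>
  define h where "h = s - (\<beta> / 2) *\<^sub>R v"
  have "0 \<le> 1 / \<beta> * inner h (P h)"
    using \<open>0 < \<beta>\<close> by (simp flip: norm_wrt_power2[OF P])
  also have "inner h (P h) = inner s (P s) - \<beta> * inner (P s) v + \<beta>\<^sup>2 / 4 * inner v (P v)"
    using pos_def_op_inner_commute[OF P, of s v]
    by (simp add: h_def linear_diff[OF lin] linear_scale[OF lin] inner_diff inner_commute
        power2_eq_square algebra_simps)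
  also have "1 / \<beta> * \<dots> = 1 / \<beta> * inner s (P s) - inner (P s) v + \<beta> / 4 * inner v (P v)"
    using \<open>0 < \<beta>\<close> by (simp add: field_simps power2_eq_square)
  finally have "inner (E x - E z) (x - w) - \<beta> / 4 * (norm_wrt P (x - w))\<^sup>2
      \<le> 1 / \<beta> * (norm_wrt (inv P) (E x - E z))\<^sup>2"
    by (simp add: Ps norm_wrt_power2[OF P] norm_wrt_power2[OF pos_def_op_inv[OF P]]
        inner_commute v_def flip: s_def)
  also have "\<dots> \<le> inner (E x - E z) (x - z)"
    using coco False by (simp add: inv_cocoercive_wrt_def)
  finally show ?thesis by (simp add: inner_diff_right)
qed

text \<open>The inclusions are tested against the point \<open>q\<close> at which the resolvent of
  \<open>A + T\<close> sends \<open>p\<close>. The weak limit of the resulting inequality is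
  \<open>inner (p - q) (p - q) \<le> 0\<close>, so \<open>p\<close> is its own resolvent and hence a
  zero.\<close>

lemma weak_cluster_is_zero:
  fixes A :: "'a::{real_inner, complete_space} \<Rightarrow> 'a set" and w u :: "'i \<Rightarrow> 'a"
  assumes A: "maximally_monotone A" and lip: "L-lipschitz_on UNIV T"
    and T: "\<And>x y. 0 \<le> inner (T x - T y) (x - y)"
    and "G \<noteq> bot" and weak: "\<And>y. ((\<lambda>k. inner (w k) y) \<longlongrightarrow> inner p y) G"
    and bd: "\<And>k. norm (w k) \<le> R" and u0: "(u \<longlongrightarrow> 0) G"
    and mem: "\<And>k. u k - T (w k) \<in> A (w k)"
  shows "- T p \<in> A p"
proof -
  have "(1 + L)-lipschitz_on UNIV (\<lambda>z. z + T z)"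
    by (intro lipschitz_on_add lip lipschitz_on_id)
  moreover have "1 * (norm (x - y))\<^sup>2 \<le> inner ((x + T x) - (y + T y)) (x - y)" for x y
    using T[of x y] by (simp add: power2_norm_eq_inner inner_diff inner_add)
  ultimately have "\<exists>!q. p - (q + T q) \<in> A q"
    by (rule ex1_strongly_monotone_plus_maximal[OF A _ zero_less_one])
  then obtain q where q: "p - (q + T q) \<in> A q" by blast
  \<comment> \<open>Monotonicity of \<open>T\<close> eliminates its values. What remains is affine
    in \<open>w k\<close> up to the pairing with \<open>u k\<close>, which vanishes because
    \<open>w\<close> is bounded.\<close>
  have ineq: "0 \<le> inner (u k) (w k - q) - inner (w k) (p - q) + inner q (p - q)" for k
    using maximally_monotoneD[OF A mem q, of k] T[of "w k" q]
    by (simp add: inner_diff inner_add inner_commute)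
  have "((\<lambda>k. inner (u k) (w k - q)) \<longlongrightarrow> 0) G"
  proof (rule Lim_null_comparison)
    show "\<forall>\<^sub>F k in G. norm (inner (u k) (w k - q)) \<le> norm (u k) * (R + norm q)"
    proof (intro always_eventually allI)
      fix k
      have "norm (w k - q) \<le> R + norm q" using norm_triangle_ineq4[of "w k" q] bd[of k] by linarith
      then show "norm (inner (u k) (w k - q)) \<le> norm (u k) * (R + norm q)"
        using Cauchy_Schwarz_ineq2[of "u k" "w k - q"] mult_left_mono[of _ _ "norm (u k)"]
        by (metis norm_ge_zero order_trans real_norm_def)
    qed
    show "((\<lambda>k. norm (u k) * (R + norm q)) \<longlongrightarrow> 0) G"
      by (rule tendsto_mult_left_zero[OF tendsto_norm_zero[OF u0]])
  qed
  then have "((\<lambda>k. inner (u k) (w k - q) - inner (w k) (p - q) + inner q (p - q)) \<longlongrightarrow>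
      0 - inner p (p - q) + inner q (p - q)) G"
    by (intro tendsto_add tendsto_diff tendsto_const weak)
  then have "0 \<le> 0 - inner p (p - q) + inner q (p - q)"
    using ineq by (intro tendsto_lowerbound[OF _ _ \<open>G \<noteq> bot\<close>] always_eventually) auto
  then have "inner (p - q) (p - q) \<le> 0" by (simp add: inner_diff_left)
  then have "p = q" by (simp flip: power2_norm_eq_inner)
  then show ?thesis using q by simp
qed

text \<open>Expanding the square, the step lowers the squared distance by at least
  \<open>\<theta> * (2 - \<theta>)\<close> times the square of
  \<open>N / norm_wrt (inv S) y\<close>. The bounds on \<open>\<theta>\<close>, \<open>N\<close> and
  \<open>y\<close> make this a multiple of \<open>(norm e)\<^sup>2\<close>.\<close>

lemma relaxed_projection_descent:
  fixes S :: "'a::{real_inner, complete_space} \<Rightarrow> 'a"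
  assumes S: "pos_def_op S" and half: "N \<le> inner y (x - z)"
    and N: "\<eta> * (norm e)\<^sup>2 \<le> N" and Y: "norm_wrt (inv S) y \<le> C * norm e"
    and "0 < \<eta>" "0 < C" "0 < \<epsilon>" and \<theta>: "\<epsilon> \<le> \<theta>" "\<theta> \<le> 2 - \<epsilon>"
    and x': "x' = x - (\<theta> * (N / (norm_wrt (inv S) y)\<^sup>2)) *\<^sub>R inv S y"
  shows "(norm_wrt S (x' - z))\<^sup>2 \<le> (norm_wrt S (x - z))\<^sup>2 - (\<epsilon> * \<eta> / C)\<^sup>2 * (norm e)\<^sup>2"
proof -
  define Y where "Y = norm_wrt (inv S) y"
  have "0 \<le> Y" unfolding Y_def by (rule norm_wrt_nonneg[OF pos_def_op_inv[OF S]])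
  have "0 \<le> \<eta> * (norm e)\<^sup>2" using \<open>0 < \<eta>\<close> by simp
  then have "0 \<le> N" using N by linarith
  show ?thesis
  proof (cases "Y = 0")
    \<comment> \<open>Here \<open>y = 0\<close>, so \<open>half\<close> gives
      \<open>N \<le> 0\<close> and the lower bound on \<open>N\<close> forces \<open>e = 0\<close>.
      Since division by zero yields \<open>0\<close>, also \<open>x' = x\<close>.\<close>
    case True
    obtain a b where "0 < b" "\<And>v. norm_wrt (inv S) v \<le> b * norm v"
      and a: "0 < a" "\<And>v. a * norm v \<le> norm_wrt (inv S) v"
      using norm_wrt_equiv[OF pos_def_op_inv[OF S]] by metis
    have "y = 0" using a(1) a(2)[of y] True by (simp add: Y_def mult_le_0_iff)
    then have "\<eta> * (norm e)\<^sup>2 \<le> 0" using N half by simp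
    then have "e = 0" using \<open>0 < \<eta>\<close> by (simp add: mult_le_0_iff)
    moreover have "x' = x" using x' True by (simp add: Y_def)
    ultimately show ?thesis by simp
  next
    case False
    then have "0 < Y" using \<open>0 \<le> Y\<close> by simp
    have lin: "linear S" using S by (simp add: pos_def_op_def bounded_linear.linear)
    have S_inv: "S (inv S y) = y"
      by (rule surj_f_inv_f[OF bij_is_surj[OF pos_def_op_bij[OF S]]])
    define \<mu> where "\<mu> = N / Y\<^sup>2"
    define v where "v = x - z"
    have "0 \<le> \<mu>" "\<mu> * Y\<^sup>2 = N" using \<open>0 \<le> N\<close> \<open>0 < Y\<close> by (auto simp: \<mu>_def)
    have "x' - z = v - (\<theta> * \<mu>) *\<^sub>R inv S y" by (simp add: x' v_def \<mu>_def Y_def)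
    then have "(norm_wrt S (x' - z))\<^sup>2 =
        inner (v - (\<theta> * \<mu>) *\<^sub>R inv S y) (S v - (\<theta> * \<mu>) *\<^sub>R y)"
      by (simp add: norm_wrt_power2[OF S] linear_diff[OF lin] linear_scale[OF lin] S_inv)
    also have "\<dots> = (norm_wrt S v)\<^sup>2 - 2 * (\<theta> * \<mu>) * inner y v + (\<theta> * \<mu>)\<^sup>2 * Y\<^sup>2"
      using pos_def_op_inner_commute[OF S, of "inv S y" v]
      unfolding Y_def norm_wrt_power2[OF S] norm_wrt_power2[OF pos_def_op_inv[OF S]]
      by (simp add: S_inv inner_diff inner_commute power2_eq_square algebra_simps)
    also have "(\<theta> * \<mu>)\<^sup>2 * Y\<^sup>2 = \<theta>\<^sup>2 * \<mu> * N"
      using \<open>\<mu> * Y\<^sup>2 = N\<close> by (simp add: power2_eq_square mult_ac)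
    also have "(norm_wrt S v)\<^sup>2 - 2 * (\<theta> * \<mu>) * inner y v + \<theta>\<^sup>2 * \<mu> * N
        \<le> (norm_wrt S v)\<^sup>2 - 2 * (\<theta> * \<mu>) * N + \<theta>\<^sup>2 * \<mu> * N"
      using half \<open>0 \<le> \<mu>\<close> \<theta> \<open>0 < \<epsilon>\<close> by (simp add: v_def mult_left_mono)
    also have "\<dots> = (norm_wrt S v)\<^sup>2 - \<theta> * (2 - \<theta>) * (\<mu> * N)"
      by (simp add: power2_eq_square algebra_simps)
    also have "\<dots> \<le> (norm_wrt S v)\<^sup>2 - \<epsilon>\<^sup>2 * (\<mu> * N)"
    proof -
      have "\<epsilon> * \<epsilon> \<le> \<theta> * (2 - \<theta>)" using \<theta> \<open>0 < \<epsilon>\<close> by (intro mult_mono) auto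
      then show ?thesis
        using mult_right_mono[of "\<epsilon> * \<epsilon>" "\<theta> * (2 - \<theta>)" "\<mu> * N"] \<open>0 \<le> \<mu>\<close> \<open>0 \<le> N\<close>
        by (simp add: power2_eq_square)
    qed
    also have "\<dots> \<le> (norm_wrt S v)\<^sup>2 - \<epsilon>\<^sup>2 * (\<eta> / C * norm e)\<^sup>2"
    proof -
      have "\<eta> / C * norm e * Y \<le> \<eta> / C * norm e * (C * norm e)"
        using Y \<open>0 < \<eta>\<close> \<open>0 < C\<close> by (intro mult_left_mono) (auto simp: Y_def)
      also have "\<dots> \<le> N" using N \<open>0 < C\<close> by (simp add: power2_eq_square)
      finally have "\<eta> / C * norm e \<le> N / Y" using \<open>0 < Y\<close> by (simp add: pos_le_divide_eq)
      then have "(\<eta> / C * norm e)\<^sup>2 \<le> (N / Y)\<^sup>2"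
        using \<open>0 < \<eta>\<close> \<open>0 < C\<close> by (intro power_mono) auto
      also have "\<dots> = \<mu> * N" by (simp add: \<mu>_def power2_eq_square)
      finally show ?thesis by (simp add: mult_left_mono)
    qed
    finally show ?thesis by (simp add: v_def power_mult_distrib power_divide)
  qed
qed

lemma set_plus_singleton_iff: "(u::'a::ab_group_add) \<in> X + {a} \<longleftrightarrow> u - a \<in> X"
proof
  assume "u - a \<in> X"
  then have "(u - a) + a \<in> X + {a}" by (intro set_plus_intro) auto
  then show "u \<in> X + {a}" by simp
qed (auto simp: set_plus_def)

lemma skew_adjoint_op_inner_self:
  fixes K :: "'a::{real_inner, complete_space} \<Rightarrow> 'a"
  assumes "skew_adjoint_op K"
  shows "inner (K v) v = 0"
  using assms adjoint_inner[of K v v] by (simp add: skew_adjoint_op_def inner_commute)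

text \<open>Eventually \<open>w k\<close> and \<open>u k\<close> enter the two neighbourhoods, and
  then \<open>u k\<close> is itself a competitor in the distance from \<open>0\<close> to
  \<open>F (w k) \<inter> V\<close>.\<close>

lemma metrically_subregular_error_bound:
  fixes w u :: "nat \<Rightarrow> 'a::{real_inner, complete_space}"
  assumes S: "pos_def_op S" and sub: "metrically_subregular_at S F p 0"
    and w: "w \<longlonglongrightarrow> p" and u: "u \<longlonglongrightarrow> 0" and mem: "\<And>k. u k \<in> F (w k)"
  shows "\<exists>\<kappa> K0. 0 \<le> \<kappa> \<and> (\<forall>k\<ge>K0. (INF z\<in>zer F. norm_wrt S (w k - z)) \<le> \<kappa> * norm (u k))"
proof -
  obtain \<kappa> U V where \<kappa>: "0 \<le> \<kappa>" "p \<in> interior U" "0 \<in> interior V"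
    "\<And>x. x \<in> U \<Longrightarrow> dist_wrt S x (inv_op F 0) \<le> ereal \<kappa> * dist_wrt S 0 (F x \<inter> V)"
    and p: "0 \<in> F p"
    using sub unfolding metrically_subregular_at_def by blast
  have "zer F \<noteq> {}" using p by (auto simp: zer_def)
  have "inv_op F 0 = zer F" by (simp add: inv_op_def zer_def)
  obtain a b where "0 < a" "\<And>v. a * norm v \<le> norm_wrt S v"
    and b: "0 < b" "\<And>v. norm_wrt S v \<le> b * norm v"
    using norm_wrt_equiv[OF S] by metis
  have "\<forall>\<^sub>F k in sequentially. w k \<in> interior U"
    using topological_tendstoD[OF w open_interior \<kappa>(2)] .
  moreover have "\<forall>\<^sub>F k in sequentially. u k \<in> interior V"
    using topological_tendstoD[OF u open_interior \<kappa>(3)] .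
  ultimately have "\<forall>\<^sub>F k in sequentially. w k \<in> interior U \<and> u k \<in> interior V"
    by (rule eventually_conj)
  then obtain K0 where K0: "\<And>k. k \<ge> K0 \<Longrightarrow> w k \<in> U" "\<And>k. k \<ge> K0 \<Longrightarrow> u k \<in> V"
    unfolding eventually_sequentially by (meson interior_subset subsetD)
  have "(INF z\<in>zer F. norm_wrt S (w k - z)) \<le> \<kappa> * b * norm (u k)" if "k \<ge> K0" for k
  proof -
    have "dist_wrt S 0 (F (w k) \<inter> V) \<le> ereal (norm_wrt S (0 - u k))"
      unfolding dist_wrt_def by (rule INF_lower) (simp add: mem K0 that)
    also have "\<dots> \<le> ereal (b * norm (u k))" using b(2)[of "0 - u k"] by simp
    finally have "ereal \<kappa> * dist_wrt S 0 (F (w k) \<inter> V) \<le> ereal \<kappa> * ereal (b * norm (u k))"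
      using \<kappa>(1) by (intro ereal_mult_left_mono) auto
    with \<kappa>(4)[OF K0(1)[OF that]]
    have "dist_wrt S (w k) (zer F) \<le> ereal \<kappa> * ereal (b * norm (u k))"
      unfolding \<open>inv_op F 0 = zer F\<close> by (rule order_trans)
    then show ?thesis by (simp add: dist_wrt_eq_INF[OF S \<open>zer F \<noteq> {}\<close>] mult_ac)
  qed
  moreover have "0 \<le> \<kappa> * b" using \<kappa>(1) b(1) by simp
  ultimately show ?thesis by blast
qed

text \<open>This transfers the error bound from \<open>xhat k\<close> to \<open>x k\<close>. The
  triangle inequality is used for the original norm, so norm equivalence contributes the
  constant.\<close>

lemma INF_norm_wrt_shift:
  fixes S :: "'a::real_inner \<Rightarrow> 'a"
  assumes S: "pos_def_op S" and "Z \<noteq> {}"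
  shows "\<exists>C>0. \<forall>x w. (INF z\<in>Z. norm_wrt S (x - z)) \<le>
    C * (norm (x - w) + (INF z\<in>Z. norm_wrt S (w - z)))"
proof -
  obtain a b where ab: "0 < a" "\<And>v. a * norm v \<le> norm_wrt S v" "0 < b" "\<And>v. norm_wrt S v \<le> b * norm v"
    using norm_wrt_equiv[OF S] by metis
  define C where "C = max b (b / a)"
  have "0 < C" "b \<le> C" "b / a \<le> C" using ab by (auto simp: C_def)
  have "(INF z\<in>Z. norm_wrt S (x - z)) \<le> C * (norm (x - w) + (INF z\<in>Z. norm_wrt S (w - z)))" for x w
  proof -
    have "(INF z\<in>Z. norm_wrt S (x - z)) / C - norm (x - w) \<le> norm_wrt S (w - z)" if "z \<in> Z" for z
    proof -
      have "(INF z\<in>Z. norm_wrt S (x - z)) \<le> norm_wrt S (x - z)"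
        by (rule cINF_lower[OF bdd_belowI2[of _ 0] that]) (rule norm_wrt_nonneg[OF S])
      also have "\<dots> \<le> b * norm (x - z)" by (rule ab)
      also have "\<dots> \<le> b * (norm (x - w) + norm (w - z))"
        using ab(3) norm_triangle_ineq[of "x - w" "w - z"] by simp
      also have "\<dots> \<le> b * norm (x - w) + b / a * norm_wrt S (w - z)"
        using ab(1,3) ab(2)[of "w - z"] by (simp add: distrib_left field_simps)
      also have "\<dots> \<le> C * norm (x - w) + C * norm_wrt S (w - z)"
        using \<open>b \<le> C\<close> \<open>b / a \<le> C\<close> norm_wrt_nonneg[OF S] by (intro add_mono mult_right_mono) auto
      finally show ?thesis using \<open>0 < C\<close> by (simp add: field_simps)
    qed
    then have "(INF z\<in>Z. norm_wrt S (x - z)) / C - norm (x - w) \<le> (INF z\<in>Z. norm_wrt S (w - z))"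
      by (intro cINF_greatest \<open>Z \<noteq> {}\<close>)
    then show ?thesis using \<open>0 < C\<close> by (simp add: field_simps)
  qed
  then show ?thesis using \<open>0 < C\<close> by blast
qed

theorem corollary3:
  fixes P S :: "'a::{real_inner, complete_space} \<Rightarrow> 'a"
    and \<beta> L\<^sub>D L\<^sub>Q \<epsilon>\<^sub>\<theta> :: real
    and B :: "'a \<Rightarrow> 'a set"
    and D E K :: "'a \<Rightarrow> 'a"
    and Q M :: "nat \<Rightarrow> 'a \<Rightarrow> 'a"
    and \<theta> \<mu> :: "nat \<Rightarrow> real"
    and x xhat :: "nat \<Rightarrow> 'a"
  assumes "pos_def_op P" and "pos_def_op S"
    and "0 \<le> \<beta>" and "\<beta> < 4"
    and "L\<^sub>D-lipschitz_on UNIV D"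
    and "inv_cocoercive_wrt P \<beta> E"
    and "skew_adjoint_op K"
    and "maximally_monotone (\<lambda>z. B z + {D z})"
    and "zer (\<lambda>z. B z + {D z} + {E z} + {K z}) \<noteq> {}"
    and "0 < \<epsilon>\<^sub>\<theta>" and "\<epsilon>\<^sub>\<theta> < 1"
    and "\<And>k. \<theta> k \<in> {\<epsilon>\<^sub>\<theta>..2 - \<epsilon>\<^sub>\<theta>}"
    and "0 < L\<^sub>Q"
    and "\<And>k. maximally_monotone (\<lambda>z. {Q k z})"
    and "\<And>k. L\<^sub>Q-lipschitz_on UNIV (Q k)"
    and "\<And>k. one_strongly_monotone_wrt P (\<lambda>z. Q k z - D z)"
    and "\<And>k z. M k z = Q k z - D z - K z"
    and "\<And>k. xhat k = the_elem (inv_op (\<lambda>z. {Q k z} + B z)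
                  (Q k (x k) - D (x k) - K (x k) - E (x k)))"
    and "\<And>k. \<mu> k = (inner (M k (x k) - M k (xhat k)) (x k - xhat k)
                      - \<beta> / 4 * (norm_wrt P (x k - xhat k))\<^sup>2)
                    / (norm_wrt (inv S) (M k (x k) - M k (xhat k)))\<^sup>2"
    and "\<And>k. x (Suc k) = x k - (\<theta> k * \<mu> k) *\<^sub>R inv S (M k (x k) - M k (xhat k))"
  shows "\<exists>xbar \<in> zer (\<lambda>z. B z + {D z} + {E z} + {K z}).
           weakly_converges_to x xbar \<and>
           ((\<forall>z \<in> zer (\<lambda>z. B z + {D z} + {E z} + {K z}).
               metrically_subregular_at S (\<lambda>z. B z + {D z} + {E z} + {K z}) z 0) \<and>
            finite_dimensional TYPE('a) \<longrightarrow>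
              locally_R_linear S x xbar \<and>
              locally_Q_linear (\<lambda>k. dist_wrt S (x k) (zer (\<lambda>z. B z + {D z} + {E z} + {K z}))))"
proof -
  note P = assms(1) and S = assms(2)

  \<comment> \<open>Properties of the operators\<close>
  define A where "A = (\<lambda>z. B z + {D z})"
  define T where "T z = E z + K z" for z
  define F where "F = (\<lambda>z. B z + {D z} + {E z} + {K z})"
  define e where "e k = x k - xhat k" for k
  define y where "y k = M k (x k) - M k (xhat k)" for k
  define u where "u k = y k - E (x k) + E (xhat k)" for k
  have A: "maximally_monotone A" using assms(8) by (simp add: A_def)
  have F_iff: "v \<in> F z \<longleftrightarrow> v - T z \<in> A z" for v z
    unfolding F_def A_def T_def set_plus_singleton_iff by (simp add: algebra_simps)
  have zer_iff: "z \<in> zer F \<longleftrightarrow> - T z \<in> A z" for z by (simp add: zer_def F_iff)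
  have linK: "linear K" and blK: "bounded_linear K"
    using assms(7) by (auto simp: skew_adjoint_op_def bounded_linear.linear)
  have K_mono: "inner (K v - K w) (v - w) = 0" for v w
    using skew_adjoint_op_inner_self[OF assms(7), of "v - w"] by (simp add: linear_diff[OF linK])
  obtain L\<^sub>K where K_lip: "L\<^sub>K-lipschitz_on UNIV K" using bounded_linear_lipschitz[OF blK] .
  obtain L\<^sub>E where E_lip: "L\<^sub>E-lipschitz_on UNIV E"
    using inv_cocoercive_wrt_lipschitz[OF P assms(3,6)] by blast
  have T_lip: "(L\<^sub>E + L\<^sub>K)-lipschitz_on UNIV T"
    unfolding T_def by (rule lipschitz_on_add[OF E_lip K_lip])
  have T_mono: "0 \<le> inner (T v - T w) (v - w)" for v w
    using inv_cocoercive_wrt_monotone[OF P assms(3,6), of v w] K_mono[of v w]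
    by (simp add: T_def inner_diff_left inner_add_left)
  obtain a b where "0 < b" "\<And>v. norm_wrt P v \<le> b * norm v"
    and a: "0 < a" "\<And>v. a * norm v \<le> norm_wrt P v"
    using norm_wrt_equiv[OF P] by metis
  have a_sq: "a\<^sup>2 * (norm v)\<^sup>2 \<le> (norm_wrt P v)\<^sup>2" for v
    using power_mono[OF a(2)[of v], of 2] a(1) by (simp add: power_mult_distrib)
  have QD_mono: "(norm_wrt P (v - w))\<^sup>2 \<le> inner ((Q k v - D v) - (Q k w - D w)) (v - w)" for k v w
    using assms(16)[of k] by (simp add: one_strongly_monotone_wrt_def)
  have QD_lip: "(L\<^sub>Q + L\<^sub>D)-lipschitz_on UNIV (\<lambda>z. Q k z - D z)" for k
    by (rule lipschitz_on_diff[OF assms(15) assms(5)])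
  have M_lip: "(L\<^sub>Q + L\<^sub>D + L\<^sub>K)-lipschitz_on UNIV (M k)" for k
    using lipschitz_on_diff[OF QD_lip[of k] K_lip] by (simp add: assms(17)[abs_def])

  \<comment> \<open>Well-definedness of the backward step\<close>
  have mem: "u k - T (xhat k) \<in> A (xhat k)" for k
  proof -
    let ?v = "Q k (x k) - D (x k) - K (x k) - E (x k)"
    have "a\<^sup>2 * (norm (v - w))\<^sup>2 \<le> inner ((Q k v - D v) - (Q k w - D w)) (v - w)" for v w
      using a_sq[of "v - w"] QD_mono[of v w k] by linarith
    \<comment> \<open>\<open>Q k + B\<close> is read as \<open>(Q k - D) + A\<close>, a Lipschitz
      strongly monotone map plus a maximally monotone operator. The preimage of \<open>?v\<close> is
      therefore a singleton, and \<open>the_elem\<close> returns its element.\<close>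
    then have "\<exists>!z. ?v - (Q k z - D z) \<in> A z"
      using a(1) by (intro ex1_strongly_monotone_plus_maximal[OF A QD_lip, of "a\<^sup>2"]) auto
    then obtain z where z: "?v - (Q k z - D z) \<in> A z" "{z. ?v - (Q k z - D z) \<in> A z} = {z}"
      by blast
    have "inv_op (\<lambda>z. {Q k z} + B z) ?v = {z. ?v - (Q k z - D z) \<in> A z}"
      by (auto simp: inv_op_def A_def set_plus_singleton_iff add.commute[of "{_}"] algebra_simps)
    then have "xhat k = z" unfolding assms(18)[of k] z(2) by simp
    then have "?v - (Q k (xhat k) - D (xhat k)) \<in> A (xhat k)" using z(1) by simp
    then show ?thesis by (simp add: u_def y_def T_def assms(17) algebra_simps)
  qed

  \<comment> \<open>Separating halfspaces and uniform descent\<close>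
  define N where "N k = inner (y k) (e k) - \<beta> / 4 * (norm_wrt P (e k))\<^sup>2" for k
  \<comment> \<open>Skewness removes \<open>K\<close> from \<open>inner (y k) (e k)\<close>, and
    strong monotonicity of \<open>Q k - D\<close> bounds it below by the squared
    \<open>P\<close>-norm of \<open>e k\<close>. After subtracting \<open>\<beta> / 4\<close> of
    that norm, \<open>\<beta> < 4\<close> leaves a positive factor; \<open>a\<^sup>2\<close> passes
    to the original norm.\<close>
  define \<eta> where "\<eta> = (1 - \<beta> / 4) * a\<^sup>2"
  have "0 < \<eta>" using assms(4) a(1) by (simp add: \<eta>_def)
  have N_ge: "\<eta> * (norm (e k))\<^sup>2 \<le> N k" for k
  proof -
    have "inner (y k) (e k) = inner ((Q k (x k) - D (x k)) - (Q k (xhat k) - D (xhat k))) (e k)"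
      using K_mono[of "x k" "xhat k"]
      by (simp add: y_def assms(17) e_def inner_diff_left algebra_simps)
    then have "(norm_wrt P (e k))\<^sup>2 \<le> inner (y k) (e k)"
      using QD_mono[where k = k and v = "x k" and w = "xhat k"] by (simp add: e_def)
    then have "(1 - \<beta> / 4) * (norm_wrt P (e k))\<^sup>2 \<le> N k" by (simp add: N_def algebra_simps)
    moreover have "\<eta> * (norm (e k))\<^sup>2 \<le> (1 - \<beta> / 4) * (norm_wrt P (e k))\<^sup>2"
      using mult_left_mono[OF a_sq[of "e k"], of "1 - \<beta> / 4"] assms(4) by (simp add: \<eta>_def mult.assoc)
    ultimately show ?thesis by linarith
  qed
  \<comment> \<open>Monotonicity of \<open>A\<close> between \<open>xhat k\<close> and
    \<open>z\<close> is used. The values \<open>E (xhat k)\<close> cancel and the \<open>K\<close>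
    terms vanish by skewness; the remaining term in \<open>E (x k) - E z\<close> is handled by the
    three-point estimate.\<close>
  have half: "N k \<le> inner (y k) (x k - z)" if "z \<in> zer F" for k z
  proof -
    have "0 \<le> inner ((u k - T (xhat k)) - (- T z)) (xhat k - z)"
      by (rule maximally_monotoneD[OF A mem that[unfolded zer_iff]])
    also have "\<dots> = inner (y k) (xhat k - z) - inner (E (x k) - E z) (xhat k - z)"
      using K_mono[of "xhat k" z]
      by (simp add: u_def T_def inner_diff_left inner_add_left)
    finally show ?thesis
      using inv_cocoercive_wrt_three_point[OF P assms(3,6), of "x k" "xhat k" z]
      by (simp add: N_def e_def inner_diff_right)
  qed
  have y_le: "norm (y k) \<le> (L\<^sub>Q + L\<^sub>D + L\<^sub>K) * norm (e k)" for k
    using lipschitz_onD[OF M_lip, of "x k" "xhat k" k] by (simp add: y_def e_def dist_norm)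
  have L_pos: "0 < L\<^sub>Q + L\<^sub>D + L\<^sub>K"
    using assms(13) lipschitz_on_nonneg[OF assms(5)] lipschitz_on_nonneg[OF K_lip] by linarith
  obtain c where c: "0 < c" "\<And>v. norm_wrt (inv S) v \<le> c * norm v"
    using norm_wrt_equiv[OF pos_def_op_inv[OF S]] by metis
  define C where "C = c * (L\<^sub>Q + L\<^sub>D + L\<^sub>K)"
  have "0 < C" using c(1) L_pos by (simp add: C_def)
  have Y_le: "norm_wrt (inv S) (y k) \<le> C * norm (e k)" for k
    using order_trans[OF c(2) mult_left_mono[OF y_le less_imp_le[OF c(1)]]]
    by (simp add: C_def mult.assoc)
  define \<rho> where "\<rho> = (\<epsilon>\<^sub>\<theta> * \<eta> / C)\<^sup>2"
  have "0 < \<rho>" using assms(10) \<open>0 < \<eta>\<close> \<open>0 < C\<close> by (simp add: \<rho>_def)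
  have descent: "(norm_wrt S (x (Suc k) - z))\<^sup>2 \<le> (norm_wrt S (x k - z))\<^sup>2 - \<rho> * (norm (e k))\<^sup>2"
    if "z \<in> zer F" for z k
    unfolding \<rho>_def
  proof (rule relaxed_projection_descent[OF S half[OF that] N_ge Y_le \<open>0 < \<eta>\<close> \<open>0 < C\<close> assms(10)])
    show "\<epsilon>\<^sub>\<theta> \<le> \<theta> k" "\<theta> k \<le> 2 - \<epsilon>\<^sub>\<theta>" using assms(12)[of k] by auto
    show "x (Suc k) = x k - (\<theta> k * (N k / (norm_wrt (inv S) (y k))\<^sup>2)) *\<^sub>R inv S (y k)"
      unfolding assms(20)[of k] assms(19)[of k] by (simp add: N_def y_def e_def)
  qed
  have fejer: "norm_wrt S (x (Suc k) - z) \<le> norm_wrt S (x k - z)" if "z \<in> zer F" for z k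
  proof (rule power2_le_imp_le[OF _ norm_wrt_nonneg[OF S]])
    have "0 \<le> \<rho> * (norm (e k))\<^sup>2" using \<open>0 < \<rho>\<close> by simp
    then show "(norm_wrt S (x (Suc k) - z))\<^sup>2 \<le> (norm_wrt S (x k - z))\<^sup>2"
      using descent[OF that, of k] by linarith
  qed

  \<comment> \<open>Vanishing residuals and boundedness\<close>
  have "zer F \<noteq> {}" using assms(9) by (simp add: F_def)
  then obtain z0 where z0: "z0 \<in> zer F" by blast
  have e0: "e \<longlonglongrightarrow> 0"
    by (rule Fejer_increments_tendsto_zero[where x = x, OF S \<open>0 < \<rho>\<close> descent[OF z0]])
  define L where "L = L\<^sub>Q + L\<^sub>D + L\<^sub>K + L\<^sub>E"
  have u_le: "norm (u k) \<le> L * norm (e k)" for k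
  proof -
    have "norm (u k) \<le> norm (y k) + norm (E (x k) - E (xhat k))"
      using norm_triangle_ineq4[of "y k" "E (x k) - E (xhat k)"] by (simp add: u_def algebra_simps)
    also have "norm (E (x k) - E (xhat k)) \<le> L\<^sub>E * norm (e k)"
      using lipschitz_onD[OF E_lip, of "x k" "xhat k"] by (simp add: e_def dist_norm)
    finally show ?thesis using y_le[of k] by (simp add: L_def distrib_right)
  qed
  have u0: "u \<longlonglongrightarrow> 0"
    by (rule Lim_null_comparison[OF always_eventually tendsto_mult_right_zero[OF tendsto_norm_zero[OF e0]]])
      (use u_le in blast)
  obtain R1 where R1: "\<And>k. norm (x k) \<le> R1"
    using Fejer_bounded[where x = x, OF S fejer[OF z0]] by blast
  obtain R2 where R2: "\<And>k. norm (e k) \<le> R2"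
    using convergent_imp_Bseq[OF convergentI[OF e0]] unfolding Bseq_def by blast
  have xhat_bd: "norm (xhat k) \<le> R1 + R2" for k
    using norm_triangle_ineq4[of "x k" "e k"] R1[of k] R2[of k] by (simp add: e_def)

  \<comment> \<open>Weak convergence\<close>
  have "\<exists>p\<in>zer F. weakly_converges_to x p"
  proof (rule Opial[where x = x, OF S \<open>zer F \<noteq> {}\<close> fejer])
    fix G p assume G: "G \<noteq> bot" "G \<le> sequentially" "\<And>v. ((\<lambda>k. inner (x k) v) \<longlongrightarrow> inner p v) G"
    \<comment> \<open>As \<open>e\<close> tends to zero, \<open>xhat\<close> has the same weak
      limits as \<open>x\<close>; the inclusion for \<open>u\<close> holds at
      \<open>xhat\<close>.\<close>
    have "((\<lambda>k. inner (xhat k) v) \<longlongrightarrow> inner p v) G" for v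
    proof -
      have "((\<lambda>k. inner (x k) v - inner (e k) v) \<longlongrightarrow> inner p v - inner 0 v) G"
        by (intro tendsto_diff G(3) tendsto_inner tendsto_mono[OF G(2) e0] tendsto_const)
      then show ?thesis by (simp add: e_def inner_diff_left)
    qed
    then have "- T p \<in> A p"
      by (rule weak_cluster_is_zero[where w = xhat, OF A T_lip T_mono G(1) _ xhat_bd tendsto_mono[OF G(2) u0] mem])
    then show "p \<in> zer F" by (simp add: zer_iff)
  qed
  then obtain p where p: "p \<in> zer F" "weakly_converges_to x p" by blast

  \<comment> \<open>Linear rates under metric subregularity\<close>
  have "locally_R_linear S x p \<and> locally_Q_linear (\<lambda>k. dist_wrt S (x k) (zer F))"
    if sub: "\<forall>z\<in>zer F. metrically_subregular_at S F z 0" and fin: "finite_dimensional TYPE('a)"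
  proof -
    have xp: "x \<longlonglongrightarrow> p" by (rule weakly_convergent_finite_dimensional[OF fin p(2)])
    have "(\<lambda>k. x k - e k) \<longlonglongrightarrow> p - 0" by (rule tendsto_diff[OF xp e0])
    then have xhatp: "xhat \<longlonglongrightarrow> p" by (simp add: e_def)
    have "u k \<in> F (xhat k)" for k using mem by (simp add: F_iff)
    then obtain \<kappa> K0 where \<kappa>: "0 \<le> \<kappa>"
      "\<And>k. k \<ge> K0 \<Longrightarrow> (INF z\<in>zer F. norm_wrt S (xhat k - z)) \<le> \<kappa> * norm (u k)"
      using metrically_subregular_error_bound[where w = xhat, OF S bspec[OF sub p(1)] xhatp u0] by blast
    obtain C2 where C2: "0 < C2" "\<And>v w. (INF z\<in>zer F. norm_wrt S (v - z)) \<le>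
        C2 * (norm (v - w) + (INF z\<in>zer F. norm_wrt S (w - z)))"
      using INF_norm_wrt_shift[OF S \<open>zer F \<noteq> {}\<close>] by blast
    \<comment> \<open>Subregularity controls the distance from \<open>xhat k\<close> by
      \<open>\<kappa> * norm (u k)\<close>, at most \<open>\<kappa> * L * norm (e k)\<close>; moving
      to \<open>x k\<close> adds a further \<open>norm (e k)\<close> and the factor
      \<open>C2\<close>.\<close>
    have bound: "(INF z\<in>zer F. norm_wrt S (x k - z)) \<le> C2 * (1 + \<kappa> * L) * norm (e k)" if "k \<ge> K0" for k
    proof -
      have "(INF z\<in>zer F. norm_wrt S (xhat k - z)) \<le> \<kappa> * (L * norm (e k))"
        using \<kappa>(2)[OF that] mult_left_mono[OF u_le[of k] \<kappa>(1)] by linarith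
      then have "C2 * (norm (x k - xhat k) + (INF z\<in>zer F. norm_wrt S (xhat k - z)))
          \<le> C2 * (norm (e k) + \<kappa> * (L * norm (e k)))"
        using C2(1) by (intro mult_left_mono add_mono) (auto simp: e_def)
      then show ?thesis using C2(2)[of "x k" "xhat k"] by (simp add: algebra_simps)
    qed
    show ?thesis
      using Fejer_descent_linear_convergence[where x = x, OF S p(1) xp \<open>0 < \<rho>\<close> descent bound] by blast
  qed
  with p show ?thesis unfolding F_def by blast
qed

end
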